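(* For every integer $r\ge 3$ there is a polynomial-time algorithm which, given an $r$-regular graph $G$, outputs a proper edge-coloring $\beta$ of $G$ satisfying $$\Sigma'(G,\beta)\le \left(1+\frac{2r}{(r+1)^2}\right)\Sigma'(G).$$
   Context: Graphs are finite, undirected, without loops or multiple edges. A proper edge-coloring of a graph $G$ is a map $\alpha:E(G)\to\mathbb{N}=\{1,2,\dots\}$ such that adjacent edges receive distinct colors. For such $\alpha$, $\Sigma'(G,\alpha)=\sum_{e\in E(G)}\alpha(e)$. The edge-chromatic sum of $G$ is $\Sigma'(G)=\min_\alpha \Sigma'(G,\alpha)$, the minimum over all proper edge-colorings $\alpha$ of $G$. *)

theory Defs
  imports Complex_Main "HOL-Computational_Algebra.Polynomial"
begin

section \<open>Simple graphs and edge-chromatic sums\<close>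

definition simple_graph :: "'a set \<Rightarrow> 'a set set \<Rightarrow> bool" where
  "simple_graph V E \<longleftrightarrow> finite V \<and> (\<forall>e\<in>E. e \<subseteq> V \<and> card e = 2)"

definition degree_at :: "'a set set \<Rightarrow> 'a \<Rightarrow> nat" where
  "degree_at E v = card {e \<in> E. v \<in> e}"

definition regular_graph :: "nat \<Rightarrow> 'a set \<Rightarrow> 'a set set \<Rightarrow> bool" where
  "regular_graph r V E \<longleftrightarrow> simple_graph V E \<and> (\<forall>v\<in>V. degree_at E v = r)"

text \<open>Colors are positive integers; the values of a coloring outside \<open>E\<close> are irrelevant.\<close>

definition proper_edge_coloring :: "'a set set \<Rightarrow> ('a set \<Rightarrow> nat) \<Rightarrow> bool" where
  "proper_edge_coloring E \<alpha> \<longleftrightarrow>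
     (\<forall>e\<in>E. \<alpha> e \<ge> 1) \<and>
     (\<forall>e\<in>E. \<forall>f\<in>E. e \<noteq> f \<and> e \<inter> f \<noteq> {} \<longrightarrow> \<alpha> e \<noteq> \<alpha> f)"

definition coloring_sum :: "'a set set \<Rightarrow> ('a set \<Rightarrow> nat) \<Rightarrow> nat" where
  "coloring_sum E \<alpha> = (\<Sum>e\<in>E. \<alpha> e)"

definition edge_chromatic_sum :: "'a set set \<Rightarrow> nat" where
  "edge_chromatic_sum E = (LEAST s. \<exists>\<alpha>. proper_edge_coloring E \<alpha> \<and> s = coloring_sum E \<alpha>)"

lemma edge_chromatic_sum_attained:
  assumes "simple_graph V E"
  shows "\<exists>\<alpha>. proper_edge_coloring E \<alpha> \<and> edge_chromatic_sum E = coloring_sum E \<alpha>"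
proof -
  have "finite E"
    using assms by (auto simp: simple_graph_def intro: finite_subset[of _ "Pow V"])
  then obtain f :: "'a set \<Rightarrow> nat" where f: "inj_on f E"
    using finite_imp_inj_to_nat_seg by metis
  have "proper_edge_coloring E (Suc \<circ> f)"
    using f by (auto simp: proper_edge_coloring_def dest: inj_onD)
  then show ?thesis
    unfolding edge_chromatic_sum_def
    by (intro LeastI_ex[where P = "\<lambda>s. \<exists>\<alpha>. proper_edge_coloring E \<alpha> \<and> s = coloring_sum E \<alpha>"]) blast
qed

lemma edge_chromatic_sum_le:
  "proper_edge_coloring E \<alpha> \<Longrightarrow> edge_chromatic_sum E \<le> coloring_sum E \<alpha>"
  unfolding edge_chromatic_sum_def by (rule Least_le) blast


section \<open>Algorithms: a unit-cost random access machine\<close>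

text \<open>
  Programs are While-programs over finitely many named memory banks; each bank is an unbounded
  array of natural numbers, addressed by computed indices. A scalar variable is cell 0 of a bank.
  The arithmetic is addition and truncated subtraction only. There is no multiplication, so a run
  of \<open>t\<close> steps handles numbers and addresses of at most \<open>O(t)\<close> bits more than the input has. This
  is the unit-cost RAM of Cook and Reckhow, whose polynomial-time computations are exactly those of
  Turing machines; with unit-cost multiplication this would fail.
\<close>

type_synonym bank = string
type_synonym state = "bank \<Rightarrow> nat \<Rightarrow> nat"

datatype aexp =
    Const nat
  | Cell bank aexp
  | Add aexp aexp
  | Sub aexp aexp

datatype bexp =
    Less aexp aexp
  | Equal aexp aexp
  | Neg bexp
  | Conj bexp bexp

datatype com =
    Skip
  | Store bank aexp aexp
  | Seq com com
  | If bexp com com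
  | While bexp com

primrec aval :: "aexp \<Rightarrow> state \<Rightarrow> nat" where
  "aval (Const k) s = k"
| "aval (Cell x i) s = s x (aval i s)"
| "aval (Add a b) s = aval a s + aval b s"
| "aval (Sub a b) s = aval a s - aval b s"

primrec bval :: "bexp \<Rightarrow> state \<Rightarrow> bool" where
  "bval (Less a b) s \<longleftrightarrow> aval a s < aval b s"
| "bval (Equal a b) s \<longleftrightarrow> aval a s = aval b s"
| "bval (Neg b) s \<longleftrightarrow> \<not> bval b s"
| "bval (Conj b c) s \<longleftrightarrow> bval b s \<and> bval c s"

primrec acost :: "aexp \<Rightarrow> nat" where
  "acost (Const k) = 1"
| "acost (Cell x i) = 1 + acost i"
| "acost (Add a b) = 1 + acost a + acost b"
| "acost (Sub a b) = 1 + acost a + acost b"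

primrec bcost :: "bexp \<Rightarrow> nat" where
  "bcost (Less a b) = 1 + acost a + acost b"
| "bcost (Equal a b) = 1 + acost a + acost b"
| "bcost (Neg b) = 1 + bcost b"
| "bcost (Conj b c) = 1 + bcost b + bcost c"

text \<open>
  \<open>exec c s t s'\<close>: started in \<open>s\<close>, the program \<open>c\<close> halts in \<open>s'\<close> after exactly \<open>t\<close> elementary
  operations. \<open>Store x i a\<close> is the assignment \<open>x[i] := a\<close>.
\<close>

inductive exec :: "com \<Rightarrow> state \<Rightarrow> nat \<Rightarrow> state \<Rightarrow> bool" where
  Skip: "exec Skip s 1 s"
| Store: "exec (Store x i a) s (1 + acost i + acost a) (s(x := (s x)(aval i s := aval a s)))"
| Seq: "exec c s t s' \<Longrightarrow> exec d s' u s'' \<Longrightarrow> exec (Seq c d) s (t + u) s''"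
| IfTrue: "bval b s \<Longrightarrow> exec c s t s' \<Longrightarrow> exec (If b c d) s (1 + bcost b + t) s'"
| IfFalse: "\<not> bval b s \<Longrightarrow> exec d s t s' \<Longrightarrow> exec (If b c d) s (1 + bcost b + t) s'"
| WhileFalse: "\<not> bval b s \<Longrightarrow> exec (While b c) s (1 + bcost b) s"
| WhileTrue: "bval b s \<Longrightarrow> exec c s t s' \<Longrightarrow> exec (While b c) s' u s'' \<Longrightarrow>
    exec (While b c) s (1 + bcost b + t + u) s''"

inductive_cases SkipE: "exec Skip s t s'"
inductive_cases StoreE: "exec (Store x i a) s t s'"
inductive_cases SeqE: "exec (Seq c d) s t s'"
inductive_cases IfE: "exec (If b c d) s t s'"
inductive_cases WhileE: "exec (While b c) s t s'"

lemma exec_deterministic: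
  "exec c s t s' \<Longrightarrow> exec c s u s'' \<Longrightarrow> u = t \<and> s'' = s'"
proof (induction arbitrary: u s'' rule: exec.induct)
  case (Skip s)
  then show ?case by (auto elim: SkipE)
next
  case (Store x i a s)
  then show ?case by (auto elim: StoreE)
next
  case (Seq c s t s' d u' s1)
  from Seq.prems show ?case by (rule SeqE) (metis Seq.IH)
next
  case (IfTrue b s c t s' d)
  from IfTrue.prems show ?case by (rule IfE) (use IfTrue.hyps in \<open>auto dest: IfTrue.IH\<close>)
next
  case (IfFalse b s d t s' c)
  from IfFalse.prems show ?case by (rule IfE) (use IfFalse.hyps in \<open>auto dest: IfFalse.IH\<close>)
next
  case (WhileFalse b s c)
  from WhileFalse.prems show ?case by (rule WhileE) (use WhileFalse.hyps in auto)
next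
  case (WhileTrue b s c t s' u' s1)
  from WhileTrue.prems show ?case by (rule WhileE) (use WhileTrue.hyps in \<open>auto dest!: WhileTrue.IH(1) dest: WhileTrue.IH(2)\<close>)
qed


section \<open>Graphs as inputs, edge colorings as outputs\<close>

text \<open>
  An input graph has vertex set \<open>{..<n}\<close> and is given by \<open>n\<close> and a list of its edges, each edge
  occurring exactly once, in either orientation. The order of the edges is arbitrary.
\<close>

definition edge_of :: "'a \<times> 'a \<Rightarrow> 'a set" where
  "edge_of p = {fst p, snd p}"

definition edge_listing :: "'a set set \<Rightarrow> ('a \<times> 'a) list \<Rightarrow> bool" where
  "edge_listing E es \<longleftrightarrow> distinct (map edge_of es) \<and> set (map edge_of es) = E"

definition input_state :: "nat \<Rightarrow> (nat \<times> nat) list \<Rightarrow> state" where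
  "input_state n es = (\<lambda>x i.
     if x = ''n'' \<and> i = 0 then n
     else if x = ''m'' \<and> i = 0 then length es
     else if x = ''src'' \<and> i < length es then fst (es ! i)
     else if x = ''dst'' \<and> i < length es then snd (es ! i)
     else 0)"

text \<open>On output, cell \<open>i\<close> of bank \<open>col\<close> holds the color of the \<open>i\<close>-th input edge.\<close>

definition outputs_coloring :: "state \<Rightarrow> (nat \<times> nat) list \<Rightarrow> (nat set \<Rightarrow> nat) \<Rightarrow> bool" where
  "outputs_coloring s es \<beta> \<longleftrightarrow> (\<forall>i<length es. \<beta> (edge_of (es ! i)) = s ''col'' i)"

text \<open>
  \<open>n + m\<close> is polynomially related to the bit length of the input as long as the graph has
  no isolated vertices.
\<close>

definition input_size :: "nat \<Rightarrow> (nat \<times> nat) list \<Rightarrow> nat" where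
  "input_size n es = n + length es"

end

theory Submission imports Defs begin

text \<open>
  Counting at each vertex, every proper coloring of an \<open>r\<close>-regular graph with \<open>m\<close> edges has sum
  at least \<open>m (r + 1) / 2\<close>. On the other hand a proper coloring with the colors \<open>1, \<dots>, r + 1\<close> and its
  reversal \<open>c \<mapsto> r + 2 - c\<close> have sums adding up to \<open>m (r + 2)\<close>, so one of them has sum at
  most \<open>m (r + 2) / 2\<close>. This gives the ratio \<open>1 + 1 / (r + 1) \<le> 1 + 2 r / (r + 1)\<^sup>2\<close>.

  The \<open>r + 1\<close> colors come from Vizing's theorem. Its proof shows that a coloring of all edges but one
  extends after a single Kempe swap followed by a recoloring of edges at one vertex, of which
  there are at most \<open>r\<close>. As \<open>r\<close> is a constant, the algorithm can afford to find the swap and the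
  recoloring by exhaustive search.
\<close>

section \<open>Kempe chains and Vizing fans\<close>

text \<open>A Kempe swap may change arbitrarily many edges, so it cannot be guessed edge by edge;
  but it is named by a vertex and two colors, which leaves \<open>n * (r + 1)^2\<close> candidates.
  The recoloring after it changes at most \<open>r\<close> edges, so \<open>(m * (r + 1))^r\<close>
  trials suffice for it. Only the existence part of Vizing's argument is needed; the program never
  computes a fan. This fixes the order of the argument. Proofs that shift a fan before swapping do
  not fit: the swap comes first, and it must leave alone the edges at the centre \<open>x\<close> of
  the fan. So the fan is cut off at a vertex \<open>v\<close> whose Kempe component avoids
  \<open>x\<close>, where \<open>x\<close> misses \<open>a\<close> and \<open>v\<close> misses
  \<open>b\<close>. After the swap both miss \<open>a\<close>, and the shift touches edges at
  \<open>x\<close> only. Edges are abstract indices with endpoint sets because the program sees them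
  as array positions. Colors run from 0 to \<open>r\<close> until the very end.\<close>

definition proper_on :: "('e \<Rightarrow> 'v set) \<Rightarrow> 'e set \<Rightarrow> ('e \<Rightarrow> nat) \<Rightarrow> bool" where
  "proper_on ed J c \<longleftrightarrow> (\<forall>p\<in>J. \<forall>q\<in>J. p \<noteq> q \<and> ed p \<inter> ed q \<noteq> {} \<longrightarrow> c p \<noteq> c q)"

definition free_at :: "('e \<Rightarrow> 'v set) \<Rightarrow> 'e set \<Rightarrow> ('e \<Rightarrow> nat) \<Rightarrow> 'v \<Rightarrow> nat \<Rightarrow> bool" where
  "free_at ed J c v k \<longleftrightarrow> (\<forall>j\<in>J. v \<in> ed j \<longrightarrow> c j \<noteq> k)"

definition kempe_rel :: "('e \<Rightarrow> 'v set) \<Rightarrow> 'e set \<Rightarrow> ('e \<Rightarrow> nat) \<Rightarrow> nat \<Rightarrow> nat \<Rightarrow> ('v \<times> 'v) set" where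
  "kempe_rel ed J c a b = {(u, w). \<exists>j\<in>J. (c j = a \<or> c j = b) \<and> ed j = {u, w}}"

definition kempe_comp :: "('e \<Rightarrow> 'v set) \<Rightarrow> 'e set \<Rightarrow> ('e \<Rightarrow> nat) \<Rightarrow> nat \<Rightarrow> nat \<Rightarrow> 'v \<Rightarrow> 'v set" where
  "kempe_comp ed J c a b v = (kempe_rel ed J c a b)\<^sup>* `` {v}"

definition swap_col :: "nat \<Rightarrow> nat \<Rightarrow> nat \<Rightarrow> nat" where
  "swap_col a b k = (if k = a then b else if k = b then a else k)"

text \<open>It is enough to ask for one end in the component: an edge of a third color that touches
  it is caught as well, but \<open>swap_col\<close> fixes its color.\<close>

definition kempe_swap ::
    "('e \<Rightarrow> 'v set) \<Rightarrow> 'e set \<Rightarrow> ('e \<Rightarrow> nat) \<Rightarrow> nat \<Rightarrow> nat \<Rightarrow> 'v \<Rightarrow> 'e \<Rightarrow> nat" where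
  "kempe_swap ed J c a b v j =
     (if j \<in> J \<and> ed j \<inter> kempe_comp ed J c a b v \<noteq> {} then swap_col a b (c j) else c j)"

text \<open>An arc from \<open>y\<close> to \<open>z\<close> says that the edge \<open>xy\<close>
  could take over the color of \<open>xz\<close> as far as \<open>y\<close> is concerned. Fans are
  paths of this relation, and reachability replaces the choice of a maximal fan sequence.\<close>

definition fan_rel :: "('e \<Rightarrow> 'v set) \<Rightarrow> 'e set \<Rightarrow> ('e \<Rightarrow> nat) \<Rightarrow> 'v \<Rightarrow> ('v \<times> 'v) set" where
  "fan_rel ed J c x = {(y, z). \<exists>j\<in>J. ed j = {x, z} \<and> free_at ed J c y (c j)}"

lemma proper_onD:
  "proper_on ed J c \<Longrightarrow> p \<in> J \<Longrightarrow> q \<in> J \<Longrightarrow> v \<in> ed p \<Longrightarrow> v \<in> ed q \<Longrightarrow> c p = c q \<Longrightarrow> p = q"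
  unfolding proper_on_def by blast

section \<open>Kempe swaps preserve proper colorings\<close>

lemma proper_on_upd:
  assumes "proper_on ed J c" "\<And>v. v \<in> ed e \<Longrightarrow> free_at ed J c v k"
  shows "proper_on ed (insert e J) (c(e := k))"
  unfolding proper_on_def
proof (intro ballI impI)
  fix p q assume pq: "p \<in> insert e J" "q \<in> insert e J" "p \<noteq> q \<and> ed p \<inter> ed q \<noteq> {}"
  then obtain v where v: "v \<in> ed p" "v \<in> ed q" by blast
  show "(c(e := k)) p \<noteq> (c(e := k)) q"
    using assms(1) assms(2)[of v] pq v by (cases "p = e"; cases "q = e") (auto simp: free_at_def proper_on_def)
qed

lemma kempe_comp_self: "v \<in> kempe_comp ed J c a b v"
  by (simp add: kempe_comp_def)

lemma sym_kempe_rel: "sym (kempe_rel ed J c a b)"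
  unfolding sym_def kempe_rel_def by (auto simp: insert_commute)

lemma kempe_comp_sym: "u \<in> kempe_comp ed J c a b v \<longleftrightarrow> v \<in> kempe_comp ed J c a b u"
  unfolding kempe_comp_def
  using symD[OF sym_rtrancl[OF sym_kempe_rel[of ed J c a b]]] by blast

lemma kempe_comp_trans:
  "u \<in> kempe_comp ed J c a b v \<Longrightarrow> w \<in> kempe_comp ed J c a b u \<Longrightarrow> w \<in> kempe_comp ed J c a b v"
  unfolding kempe_comp_def by auto

lemma card2_other: "card A = 2 \<Longrightarrow> u \<in> A \<Longrightarrow> \<exists>w. w \<noteq> u \<and> A = {u, w}"
  by (auto simp: card_2_iff)

lemma kempe_comp_closed:
  assumes "u \<in> kempe_comp ed J c a b v" "j \<in> J" "c j = a \<or> c j = b" "u \<in> ed j" "card (ed j) = 2"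
  shows "ed j \<subseteq> kempe_comp ed J c a b v"
proof -
  obtain w where w: "ed j = {u, w}" using card2_other[OF assms(5,4)] by blast
  then have "(u, w) \<in> kempe_rel ed J c a b"
    unfolding kempe_rel_def using assms by auto
  then have "w \<in> kempe_comp ed J c a b v"
    using assms(1) unfolding kempe_comp_def by auto
  then show ?thesis using w assms(1) by auto
qed

text \<open>A component is closed under edges colored \<open>a\<close> or \<open>b\<close>, so an
  edge that crosses its boundary has a third color, which the swap fixes.\<close>

lemma kempe_swap_outside:
  assumes "v \<notin> kempe_comp ed J c a b u" "\<forall>j\<in>J. card (ed j) = 2" "v \<in> ed j"
  shows "kempe_swap ed J c a b u j = c j"
proof (cases "j \<in> J \<and> ed j \<inter> kempe_comp ed J c a b u \<noteq> {} \<and> (c j = a \<or> c j = b)")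
  case True
  then show ?thesis using kempe_comp_closed[of _ ed J c a b u j] assms by blast
qed (auto simp: kempe_swap_def swap_col_def)

lemma swap_col_inj: "swap_col a b k = swap_col a b l \<longleftrightarrow> k = l"
  by (auto simp: swap_col_def)

text \<open>At a common vertex inside the component both colors pass through the same injection
  \<open>swap_col\<close>; at one outside it neither color changes.\<close>

lemma proper_on_kempe_swap:
  assumes "proper_on ed J c" "\<forall>j\<in>J. card (ed j) = 2"
  shows "proper_on ed J (kempe_swap ed J c a b u)"
  unfolding proper_on_def
proof (intro ballI impI)
  fix p q assume pq: "p \<in> J" "q \<in> J" "p \<noteq> q \<and> ed p \<inter> ed q \<noteq> {}"
  then obtain v where v: "v \<in> ed p" "v \<in> ed q" by blast
  have ne: "c p \<noteq> c q" using pq assms(1) by (auto simp: proper_on_def)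
  show "kempe_swap ed J c a b u p \<noteq> kempe_swap ed J c a b u q"
  proof (cases "v \<in> kempe_comp ed J c a b u")
    case True
    then show ?thesis using ne pq v by (auto simp: kempe_swap_def swap_col_inj)
  next
    case False
    then show ?thesis using kempe_swap_outside[OF False assms(2)] v ne by auto
  qed
qed

lemma free_at_kempe_swap_outside:
  assumes "v \<notin> kempe_comp ed J c a b u" "\<forall>j\<in>J. card (ed j) = 2"
  shows "free_at ed J (kempe_swap ed J c a b u) v k \<longleftrightarrow> free_at ed J c v k"
  using kempe_swap_outside[OF assms] by (auto simp: free_at_def)

lemma free_at_kempe_swap_inside:
  assumes "v \<in> kempe_comp ed J c a b u"
  shows "free_at ed J (kempe_swap ed J c a b u) v (swap_col a b k) \<longleftrightarrow> free_at ed J c v k"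
proof -
  have "kempe_swap ed J c a b u j = swap_col a b (c j)" if "j \<in> J" "v \<in> ed j" for j
    using that assms by (auto simp: kempe_swap_def)
  then show ?thesis by (auto simp: free_at_def swap_col_inj)
qed

lemma kempe_swap_same: "kempe_swap ed J c a a u = c"
  by (auto simp: kempe_swap_def swap_col_def)

lemma kempe_swap_le: "a \<le> r \<Longrightarrow> b \<le> r \<Longrightarrow> \<forall>j. c j \<le> r \<Longrightarrow> kempe_swap ed J c a b u j \<le> r"
  by (auto simp: kempe_swap_def swap_col_def)

text \<open>Each vertex of the component other than \<open>x\<close> is sent to the last edge of a shortest path
  from \<open>x\<close>.\<close>

lemma card_kempe_comp_le:
  fixes ed :: "'e \<Rightarrow> 'v set" and c :: "'e \<Rightarrow> nat" and x :: 'v and a b :: nat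
  assumes "finite J"
  defines "C \<equiv> kempe_comp ed J c a b x"
  shows "finite C" "card C \<le> Suc (card {j \<in> J. (c j = a \<or> c j = b) \<and> ed j \<subseteq> C})"
proof -
  let ?R = "kempe_rel ed J c a b"
  let ?JC = "{j \<in> J. (c j = a \<or> c j = b) \<and> ed j \<subseteq> C}"
  define d where "d v = (LEAST k. (x, v) \<in> ?R ^^ k)" for v
  have ex: "\<exists>j. j \<in> ?JC \<and> (\<exists>u. ed j = {u, v} \<and> d u < d v)" if v: "v \<in> C - {x}" for v
  proof -
    have "(x, v) \<in> ?R\<^sup>*" using v by (simp add: C_def kempe_comp_def)
    then have "\<exists>k. (x, v) \<in> ?R ^^ k" by (simp add: rtrancl_is_UN_relpow)
    then have dv: "(x, v) \<in> ?R ^^ d v" unfolding d_def by (rule LeastI_ex)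
    then obtain k where k: "d v = Suc k" using v by (cases "d v") auto
    with dv obtain u where u: "(x, u) \<in> ?R ^^ k" "(u, v) \<in> ?R" by auto
    have "d u \<le> k" unfolding d_def by (rule Least_le) (rule u(1))
    moreover have "u \<in> C" using u(1) by (auto simp: C_def kempe_comp_def relpow_imp_rtrancl)
    moreover obtain j where "j \<in> J" "c j = a \<or> c j = b" "ed j = {u, v}"
      using u(2) by (auto simp: kempe_rel_def)
    ultimately show ?thesis using k v by (intro exI[of _ j]) auto
  qed
  have "\<exists>f. \<forall>v\<in>C - {x}. f v \<in> ?JC \<and> (\<exists>u. ed (f v) = {u, v} \<and> d u < d v)"
    using ex by (intro bchoice ballI)
  then obtain f where f': "\<forall>v\<in>C - {x}. f v \<in> ?JC \<and> (\<exists>u. ed (f v) = {u, v} \<and> d u < d v)" ..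
  note f = bspec[OF f']
  have inj: "inj_on f (C - {x})"
  proof (rule inj_onI)
    fix v w assume vw: "v \<in> C - {x}" "w \<in> C - {x}" "f v = f w"
    from f[OF vw(1)] obtain u where u: "ed (f v) = {u, v}" "d u < d v" by blast
    from f[OF vw(2)] obtain u' where u': "ed (f w) = {u', w}" "d u' < d w" by blast
    \<comment> \<open>Otherwise \<open>u = w\<close> and \<open>u' = v\<close>, so each of
      \<open>v\<close> and \<open>w\<close> would be strictly nearer to \<open>x\<close> than the
      other.\<close>
    show "v = w" using u u' vw(3) by (auto simp: doubleton_eq_iff)
  qed
  have fin: "finite ?JC" using assms(1) by simp
  have sub: "f ` (C - {x}) \<subseteq> ?JC"
    by (rule image_subsetI) (rule f[THEN conjunct1])
  have "finite (C - {x})" using finite_subset[OF sub fin] inj by (simp add: finite_image_iff)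
  then show C: "finite C" by simp
  have "card (C - {x}) \<le> card ?JC" using card_inj_on_le[OF inj sub fin] .
  moreover have "x \<in> C" by (simp add: C_def kempe_comp_self)
  ultimately show "card C \<le> Suc (card ?JC)"
    using card_Suc_Diff1[OF C, of x] by linarith
qed

text \<open>Three vertices of degree at most one would push the degree sum below
  \<open>2 (card C - 1)\<close>.\<close>

lemma kempe_comp_two_ends:
  assumes fin: "finite J" and card2: "\<forall>j\<in>J. card (ed j) = 2" and proper: "proper_on ed J c"
    and ends: "\<And>v. v \<in> {x, y, z} \<Longrightarrow> free_at ed J c v a \<or> free_at ed J c v b"
    and dist: "x \<noteq> y" "x \<noteq> z" "y \<noteq> z"
    and mem: "y \<in> kempe_comp ed J c a b x" "z \<in> kempe_comp ed J c a b x"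
  shows False
proof -
  define C where "C = kempe_comp ed J c a b x"
  define K where "K = {j \<in> J. (c j = a \<or> c j = b) \<and> ed j \<subseteq> C}"
  have finC: "finite C" and le: "card C \<le> Suc (card K)"
    using card_kempe_comp_le[OF fin, of ed c a b x] by (simp_all add: C_def K_def)
  have finK: "finite K" using fin by (simp add: K_def)
  have one: "card {j \<in> K. v \<in> ed j \<and> c j = k} \<le> 1" for v k
  proof -
    have "p = q" if "p \<in> {j \<in> K. v \<in> ed j \<and> c j = k}" "q \<in> {j \<in> K. v \<in> ed j \<and> c j = k}" for p q
      using that proper_onD[OF proper, of p q v] by (simp add: K_def)
    then show ?thesis using finK by (simp add: card_le_Suc0_iff_eq)
  qed
  have split: "{j \<in> K. v \<in> ed j} = {j \<in> K. v \<in> ed j \<and> c j = a} \<union> {j \<in> K. v \<in> ed j \<and> c j = b}" for v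
    by (auto simp: K_def)
  have deg2: "card {j \<in> K. v \<in> ed j} \<le> 2" for v
    unfolding split using one[of v a] one[of v b]
      card_Un_le[of "{j \<in> K. v \<in> ed j \<and> c j = a}" "{j \<in> K. v \<in> ed j \<and> c j = b}"] by linarith
  have deg1: "card {j \<in> K. v \<in> ed j} \<le> 1" if "v \<in> {x, y, z}" for v
  proof -
    from ends[OF that]
    have "{j \<in> K. v \<in> ed j \<and> c j = a} = {} \<or> {j \<in> K. v \<in> ed j \<and> c j = b} = {}"
      by (auto simp: free_at_def K_def)
    then show ?thesis unfolding split
      using one[of v a] one[of v b] by (elim disjE) (simp_all only: Un_empty_left Un_empty_right)
  qed
  \<comment> \<open>Incidences between \<open>K\<close> and \<open>C\<close> are counted from both
    sides.\<close>
  have "2 * card K = (\<Sum>j\<in>K. card {v \<in> C. v \<in> ed j})"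
  proof -
    have "card {v \<in> C. v \<in> ed j} = 2" if "j \<in> K" for j
    proof -
      have "{v \<in> C. v \<in> ed j} = ed j" using that by (auto simp: K_def)
      then show ?thesis using that card2 by (auto simp: K_def)
    qed
    then show ?thesis by simp
  qed
  also have "\<dots> = (\<Sum>v\<in>C. card {j \<in> K. v \<in> ed j})"
    using sum_multicount_gen[OF finK finC, of "\<lambda>j v. v \<in> ed j"] by simp
  also have "\<dots> = (\<Sum>v\<in>C - {x,y,z}. card {j \<in> K. v \<in> ed j}) + (\<Sum>v\<in>{x,y,z}. card {j \<in> K. v \<in> ed j})"
    using mem finC kempe_comp_self[of x ed J c a b] by (intro sum.subset_diff) (auto simp: C_def)
  also have "\<dots> \<le> (\<Sum>v\<in>C - {x,y,z}. 2) + (\<Sum>v\<in>{x,y,z}. 1)"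
    by (intro add_mono sum_mono deg2 deg1)
  also have "\<dots> = 2 * (card C - 3) + 3"
  proof -
    have "card (C - {x,y,z}) = card C - card {x,y,z}"
      using mem kempe_comp_self[of x ed J c a b] by (intro card_Diff_subset) (auto simp: C_def)
    then show ?thesis using dist by simp
  qed
  finally have "2 * card K \<le> 2 * (card C - 3) + 3" .
  \<comment> \<open>This makes the truncated \<open>card C - 3\<close> a true difference, so the
    bound reads \<open>2 * card K + 3 \<le> 2 * card C\<close>, against
    \<open>card C \<le> Suc (card K)\<close>.\<close>
  moreover have "card {x, y, z} \<le> card C"
    using mem finC kempe_comp_self[of x ed J c a b] by (intro card_mono) (auto simp: C_def)
  ultimately show False using le dist by simp
qed

section \<open>Fans as paths, and shifting along them\<close>

lemma rtrancl_distinct_path: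
  assumes "(u, v) \<in> R\<^sup>*"
  shows "\<exists>p. p \<noteq> [] \<and> hd p = u \<and> last p = v \<and> distinct p \<and> successively (\<lambda>y z. (y, z) \<in> R) p"
  using assms
proof (induction rule: rtrancl_induct)
  case base
  show ?case by (rule exI[of _ "[u]"]) simp
next
  case (step v w)
  then obtain p where p: "p \<noteq> []" "hd p = u" "last p = v" "distinct p"
    "successively (\<lambda>y z. (y, z) \<in> R) p" by blast
  show ?case
  proof (cases "w \<in> set p")
    case True
    then obtain as bs where "p = as @ w # bs" by (meson split_list)
    with p show ?thesis
      by (intro exI[of _ "as @ [w]"]) (auto simp: successively_append_iff hd_append)
  next
    case False
    with p step(2) show ?thesis
      by (intro exI[of _ "p @ [w]"]) (auto simp: successively_append_iff)
  qed
qed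

text \<open>Keeping only the arcs that leave non-\<open>P\<close> vertices records that
  \<open>w\<close> is the first \<open>P\<close>-vertex on its path. In this form the path can later
  be carried into another relation by monotonicity.\<close>

lemma rtrancl_first:
  assumes "(u, v) \<in> R\<^sup>*" "P v"
  shows "\<exists>w. P w \<and> (u, w) \<in> {(y, z) \<in> R. \<not> P y}\<^sup>*"
proof -
  have "(\<exists>w. P w \<and> (u, w) \<in> {(y, z) \<in> R. \<not> P y}\<^sup>*) \<or> (u, v) \<in> {(y, z) \<in> R. \<not> P y}\<^sup>*"
    using assms(1)
  proof (induction rule: rtrancl_induct)
    case (step y z)
    then show ?case by (cases "P y") (auto intro: rtrancl_into_rtrancl)
  qed simp
  then show ?thesis using assms(2) by blast
qed

text \<open>The fan is shifted from its far end, so that each step recolors a single edge with a color free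
  at both of its ends.\<close>

lemma fan_shift:
  assumes card2: "\<forall>j\<in>insert e J. card (ed j) = 2" and e: "ed e = {x, y}"
    and "p \<noteq> []" "hd p = y" "distinct p" "successively (\<lambda>y z. (y, z) \<in> fan_rel ed J c x) p"
    and "free_at ed J c x k" "free_at ed J c (last p) k" "k \<le> r"
    and "proper_on ed J c" "\<forall>j. c j \<le> r"
  shows "\<exists>c'. proper_on ed (insert e J) c' \<and> (\<forall>j. c' j \<le> r) \<and>
              (\<forall>j. c' j \<noteq> c j \<longrightarrow> j \<in> insert e J \<and> x \<in> ed j)"
  using assms(3-)
proof (induction p arbitrary: c k rule: rev_induct)
  case (snoc z p)
  show ?case
  proof (cases "p = []")
    case True
    then have z: "z = y" using snoc.prems by simp
    have "proper_on ed (insert e J) (c(e := k))"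
      using snoc.prems e z by (intro proper_on_upd) auto
    moreover have "\<forall>j. (c(e := k)) j \<le> r" using snoc.prems by simp
    moreover have "\<forall>j. (c(e := k)) j \<noteq> c j \<longrightarrow> j \<in> insert e J \<and> x \<in> ed j" using e by simp
    ultimately show ?thesis by blast
  next
    case False
    have "(last p, z) \<in> fan_rel ed J c x"
      using snoc.prems False by (simp add: successively_append_iff)
    then obtain j where j: "j \<in> J" "ed j = {x, z}" "free_at ed J c (last p) (c j)"
      by (auto simp: fan_rel_def)
    \<comment> \<open>Every vertex of the path after the first is the target of an arc, so it is
      joined to \<open>x\<close> by an edge; for \<open>x\<close> itself that edge would have a
      single end.\<close>
    have xne: "x \<notin> set p"
    proof
      assume "x \<in> set p"
      moreover have "x \<noteq> y" using card2 e by auto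
      ultimately obtain as bs where ab: "p = as @ x # bs" "as \<noteq> []"
        using snoc.prems(2) False by (metis append_Nil hd_append2 list.sel(1) split_list)
      then have "(last as, x) \<in> fan_rel ed J c x"
        using snoc.prems by (simp add: successively_append_iff)
      then show False using card2 by (auto simp: fan_rel_def)
    qed
    have znp: "z \<notin> set p" using snoc.prems by simp
    \<comment> \<open>The edge \<open>xz\<close> takes \<open>k\<close> and gives up
      \<open>c j\<close>, which is free at \<open>last p\<close> by the arc and from now on also at
      \<open>x\<close>. So the shorter path \<open>p\<close> meets the induction hypothesis with
      \<open>c j\<close> in place of \<open>k\<close>.\<close>
    define c1 where "c1 = c(j := k)"
    have off: "c1 i = c i" if "u \<in> ed i" "u \<in> set p" for i u
      using that j(2) xne znp by (auto simp: c1_def)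
    have free1: "free_at ed J c1 u l \<longleftrightarrow> free_at ed J c u l" if "u \<in> set p" for u l
      using off[OF _ that] by (auto simp: free_at_def)
    have "successively (\<lambda>y z. (y, z) \<in> fan_rel ed J c1 x) p"
    proof (rule successively_mono)
      show "successively (\<lambda>y z. (y, z) \<in> fan_rel ed J c x) p"
        using snoc.prems by (simp add: successively_append_iff)
      fix u w assume uw: "u \<in> set p" "w \<in> set p" "(u, w) \<in> fan_rel ed J c x"
      then obtain i where i: "i \<in> J" "ed i = {x, w}" "free_at ed J c u (c i)"
        by (auto simp: fan_rel_def)
      have "c1 i = c i" using off[of w i] i uw by auto
      then show "(u, w) \<in> fan_rel ed J c1 x"
        using i free1[OF uw(1)] unfolding fan_rel_def by force
    qed
    moreover have "proper_on ed J c1"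
    proof -
      have "proper_on ed (insert j J) c1"
        unfolding c1_def using snoc.prems j by (intro proper_on_upd) auto
      then show ?thesis using j by (simp add: insert_absorb)
    qed
    moreover have "free_at ed J c1 x (c j)"
    proof -
      have "k \<noteq> c j" using snoc.prems(5) j by (auto simp: free_at_def)
      moreover have "c i \<noteq> c j" if "i \<in> J" "x \<in> ed i" "i \<noteq> j" for i
        using that j snoc.prems(8) by (auto simp: proper_on_def)
      ultimately show ?thesis by (auto simp: free_at_def c1_def)
    qed
    moreover have "free_at ed J c1 (last p) (c j)"
      using free1[of "last p"] j False by simp
    moreover have "\<forall>j. c1 j \<le> r" using snoc.prems by (simp add: c1_def)
    ultimately obtain c' where c': "proper_on ed (insert e J) c'" "\<forall>j. c' j \<le> r"
        "\<forall>j. c' j \<noteq> c1 j \<longrightarrow> j \<in> insert e J \<and> x \<in> ed j"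
      using snoc.IH[of c1 "c j"] snoc.prems False by auto
    have "\<forall>i. c' i \<noteq> c i \<longrightarrow> i \<in> insert e J \<and> x \<in> ed i"
    proof (intro allI impI)
      fix i assume ne: "c' i \<noteq> c i"
      show "i \<in> insert e J \<and> x \<in> ed i"
      proof (cases "i = j")
        case False
        then have "c1 i = c i" by (simp add: c1_def)
        then show ?thesis using c'(3) ne by simp
      qed (use j in auto)
    qed
    then show ?thesis using c' by blast
  qed
qed simp

section \<open>Vizing's extension by one edge\<close>

lemma free_color_exists:
  assumes "finite J" "card {j \<in> J. v \<in> ed j} \<le> r"
  shows "\<exists>k\<le>r. free_at ed J c v k"
proof -
  have "card (c ` {j \<in> J. v \<in> ed j}) \<le> r"
    using assms card_image_le[of "{j \<in> J. v \<in> ed j}" c] by simp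
  then have "\<not> {..r} \<subseteq> c ` {j \<in> J. v \<in> ed j}"
    using card_mono[of "c ` {j \<in> J. v \<in> ed j}" "{..r}"] assms(1) by auto
  then show ?thesis by (auto simp: free_at_def)
qed

text \<open>The conclusion has the shape of the search space: a vertex and two colors for the swap,
  then changes confined to the edges at one vertex \<open>x\<close>, of which there are at most
  \<open>r\<close>.\<close>

lemma vizing_step:
  assumes fin: "finite J" and e: "e \<notin> J" and inj: "inj_on ed (insert e J)"
    and card2: "\<forall>j\<in>insert e J. card (ed j) = 2"
    and deg: "\<And>v. card {j \<in> insert e J. v \<in> ed j} \<le> r"
    and proper: "proper_on ed J c" and le: "\<forall>j. c j \<le> r"
  shows "\<exists>a b v c' x. a \<le> r \<and> b \<le> r \<and> v \<in> \<Union> (ed ` insert e J) \<and>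
           proper_on ed (insert e J) c' \<and> (\<forall>j. c' j \<le> r) \<and>
           (\<forall>j. c' j \<noteq> kempe_swap ed J c a b v j \<longrightarrow> j \<in> insert e J \<and> x \<in> ed j)"
proof -
  have cJ: "\<forall>j\<in>J. card (ed j) = 2" using card2 by simp
  obtain x y0 where xy: "ed e = {x, y0}" "x \<noteq> y0"
    using card2 by (auto simp: card_2_iff)
  have shift: "\<exists>c'. proper_on ed (insert e J) c' \<and> (\<forall>j. c' j \<le> r) \<and>
              (\<forall>j. c' j \<noteq> c1 j \<longrightarrow> j \<in> insert e J \<and> x \<in> ed j)"
    if "(y0, z) \<in> (fan_rel ed J c1 x)\<^sup>*" "free_at ed J c1 x k" "free_at ed J c1 z k" "k \<le> r"
       "proper_on ed J c1" "\<forall>j. c1 j \<le> r" for c1 z k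
  proof -
    note h = that
    obtain p where p: "p \<noteq> []" "hd p = y0" "last p = z" "distinct p"
        "successively (\<lambda>y z. (y, z) \<in> fan_rel ed J c1 x) p"
      using rtrancl_distinct_path[OF h(1)] by blast
    then show ?thesis
      by (intro fan_shift[OF card2 xy(1), of p]) (use h p in simp_all)
  qed
  have exfree: "\<exists>k\<le>r. free_at ed J c v k" for v
  proof (rule free_color_exists[OF fin])
    have "card {j \<in> J. v \<in> ed j} \<le> card {j \<in> insert e J. v \<in> ed j}"
      using fin by (intro card_mono) auto
    then show "card {j \<in> J. v \<in> ed j} \<le> r" using deg[of v] by linarith
  qed
  define R where "R = fan_rel ed J c x"
  define F where "F = R\<^sup>* `` {y0}"
  show ?thesis
  proof (cases "\<exists>z\<in>F. \<exists>k\<le>r. free_at ed J c x k \<and> free_at ed J c z k")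
    case True
    then obtain z k where "z \<in> F" "k \<le> r" "free_at ed J c x k" "free_at ed J c z k" by blast
    then obtain c' where "proper_on ed (insert e J) c'" "\<forall>j. c' j \<le> r"
              "\<forall>j. c' j \<noteq> c j \<longrightarrow> j \<in> insert e J \<and> x \<in> ed j"
      using shift[of z c k] proper le by (auto simp: F_def R_def)
    \<comment> \<open>No swap is wanted here; with equal colors it is the identity.\<close>
    then show ?thesis
      using xy by (intro exI[of _ 0] exI[of _ y0] exI[of _ c'] exI[of _ x]) (simp add: kempe_swap_same)
  next
    case False
    have "\<exists>\<mu>. \<forall>v. \<mu> v \<le> r \<and> free_at ed J c v (\<mu> v)"
      using exfree by (intro choice) blast
    then obtain \<mu> where \<mu>: "\<And>v. \<mu> v \<le> r \<and> free_at ed J c v (\<mu> v)" by blast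
    define K where "K = {j \<in> J. \<exists>z\<in>F. ed j = {x, z}}"
    \<comment> \<open>A color missing at \<open>y\<close> in \<open>F\<close> is present at
      \<open>x\<close>, say on \<open>xz\<close>. That edge is an arc from \<open>y\<close> to
      \<open>z\<close>, so \<open>z\<close> is in \<open>F\<close> too.\<close>
    have FK: "\<mu> ` F \<subseteq> c ` K"
    proof
      fix k assume "k \<in> \<mu> ` F"
      then obtain y where y: "y \<in> F" "k = \<mu> y" by blast
      then have "\<not> free_at ed J c x k" using False \<mu> by blast
      then obtain j where j: "j \<in> J" "x \<in> ed j" "c j = k" by (auto simp: free_at_def)
      obtain z where z: "ed j = {x, z}" using card2_other[OF _ j(2)] cJ j by blast
      then have "(y, z) \<in> R" using \<mu> j y unfolding R_def fan_rel_def by auto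
      then have "z \<in> F" using y(1) by (auto simp: F_def)
      then show "k \<in> c ` K" using j z by (auto simp: K_def)
    qed
    have finK: "finite K" using fin by (simp add: K_def)
    have "F \<subseteq> insert y0 (\<Union> (ed ` J))"
    proof
      fix z assume "z \<in> F"
      then have "(y0, z) \<in> R\<^sup>*" by (simp add: F_def)
      then show "z \<in> insert y0 (\<Union> (ed ` J))"
        by (cases rule: rtranclE) (auto simp: R_def fan_rel_def)
    qed
    moreover have "finite (\<Union> (ed ` J))"
      using fin cJ by (auto intro: card_ge_0_finite)
    ultimately have finF: "finite F" using finite_subset by blast
    have y0F: "y0 \<in> F" by (simp add: F_def)
    \<comment> \<open>The only edge joining \<open>x\<close> to \<open>y0\<close> is the uncolored
      \<open>e\<close>. So the colored edges from \<open>x\<close> into \<open>F\<close> are fewer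
      than the vertices of \<open>F\<close>, and two of these vertices share their chosen missing
      color.\<close>
    have "card K \<le> card (F - {y0})"
    proof (rule card_inj_on_le[where f = "\<lambda>j. THE z. ed j = {x, z}"])
      have the: "(THE z. ed j = {x, z}) = z" if "ed j = {x, z}" for j z
        using that by (auto simp: doubleton_eq_iff)
      show "inj_on (\<lambda>j. THE z. ed j = {x, z}) K"
      proof (rule inj_onI)
        fix i j assume ij: "i \<in> K" "j \<in> K" "(THE z. ed i = {x, z}) = (THE z. ed j = {x, z})"
        obtain z w where zw: "ed i = {x, z}" "ed j = {x, w}" using ij by (auto simp: K_def)
        have "z = w" using ij(3) unfolding the[OF zw(1)] the[OF zw(2)] .
        then have "ed i = ed j" using zw by simp
        then show "i = j" using inj ij by (auto simp: K_def inj_on_def)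
      qed
      show "(\<lambda>j. THE z. ed j = {x, z}) ` K \<subseteq> F - {y0}"
      proof (clarify)
        fix j assume "j \<in> K"
        then obtain z where z: "j \<in> J" "z \<in> F" "ed j = {x, z}" by (auto simp: K_def)
        then have "z \<noteq> y0" using inj e xy by (auto simp: inj_on_def)
        then show "(THE z. ed j = {x, z}) \<in> F - {y0}" using z the[OF z(3)] by simp
      qed
      show "finite (F - {y0})" using finF by simp
    qed
    also have "\<dots> < card F" using finF y0F by (intro psubset_card_mono) auto
    finally have "card (\<mu> ` F) < card F"
      using card_mono[OF _ FK] card_image_le[OF finK, of c] finK by simp
    then obtain y z where yz: "y \<in> F" "z \<in> F" "y \<noteq> z" "\<mu> y = \<mu> z"
      using pigeonhole[of \<mu> F] by (auto simp: inj_on_def)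
    define b where "b = \<mu> y"
    have b: "b \<le> r" "free_at ed J c y b" "free_at ed J c z b"
      using \<mu>[of y] \<mu>[of z] yz by (simp_all add: b_def)
    obtain a where a: "a \<le> r" "free_at ed J c x a" using exfree by blast
    have anb: "a \<noteq> b" using False a b yz by blast
    have Fx: "v \<noteq> x" if "v \<in> F" for v
    proof -
      have "(y0, v) \<in> R\<^sup>*" using that by (simp add: F_def)
      then show ?thesis using xy(2) cJ by (cases rule: rtranclE) (auto simp: R_def fan_rel_def)
    qed
    have restr: "w \<in> F" if "(y0, w) \<in> S\<^sup>*" "S \<subseteq> R" for S w
      using rtrancl_mono[OF that(2)] that(1) by (auto simp: F_def)
    \<comment> \<open>A swap at \<open>v\<close> keeps the fan path to \<open>v\<close> intact if no earlier vertex of the path is in its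
      component and misses \<open>b\<close>. The first vertex \<open>u\<close> on the path that misses \<open>b\<close> will do, unless its
      component contains \<open>x\<close>; then the component of the next one contains neither \<open>x\<close> nor \<open>u\<close>.\<close>
    have "\<exists>v. v \<in> F \<and> free_at ed J c v b \<and> x \<notin> kempe_comp ed J c a b v \<and>
              (y0, v) \<in> {(u, w) \<in> R. \<not> (u \<in> kempe_comp ed J c a b v \<and> free_at ed J c u b)}\<^sup>*"
    proof -
      obtain u where u: "free_at ed J c u b" "(y0, u) \<in> {(u, w) \<in> R. \<not> free_at ed J c u b}\<^sup>*"
        using rtrancl_first[of y0 y R "\<lambda>u. free_at ed J c u b"] yz b by (auto simp: F_def)
      have uF: "u \<in> F" by (rule restr[OF u(2)]) auto
      show ?thesis
      proof (cases "x \<in> kempe_comp ed J c a b u")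
        case False
        have "(y0, u) \<in> {(v, w) \<in> R. \<not> (v \<in> kempe_comp ed J c a b u \<and> free_at ed J c v b)}\<^sup>*"
          by (rule rtrancl_mono[THEN subsetD, OF _ u(2)]) auto
        then show ?thesis using False u uF by blast
      next
        case True
        obtain v0 where "v0 \<in> F" "free_at ed J c v0 b" "v0 \<noteq> u" using yz(1-3) b(2,3) by blast
        then obtain v where v: "free_at ed J c v b" "v \<noteq> u"
            "(y0, v) \<in> {(t, w) \<in> R. \<not> (free_at ed J c t b \<and> t \<noteq> u)}\<^sup>*"
          using rtrancl_first[of y0 v0 R "\<lambda>t. free_at ed J c t b \<and> t \<noteq> u"] by (auto simp: F_def)
        have vF: "v \<in> F" by (rule restr[OF v(3)]) auto
        have ux: "u \<in> kempe_comp ed J c a b x" using True by (rule kempe_comp_sym[THEN iffD1])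
        have "v \<notin> kempe_comp ed J c a b x"
        proof
          assume "v \<in> kempe_comp ed J c a b x"
          then show False
            using kempe_comp_two_ends[OF fin cJ proper, of x u v a b] ux Fx[OF uF] Fx[OF vF] u(1) v a by auto
        qed
        then have xv: "x \<notin> kempe_comp ed J c a b v" "u \<notin> kempe_comp ed J c a b v"
          using kempe_comp_sym[of v ed J c a b x] kempe_comp_sym[of v ed J c a b u]
            kempe_comp_trans[OF ux] by blast+
        have "(y0, v) \<in> {(t, w) \<in> R. \<not> (t \<in> kempe_comp ed J c a b v \<and> free_at ed J c t b)}\<^sup>*"
          by (rule rtrancl_mono[THEN subsetD, OF _ v(3)]) (use xv in auto)
        then show ?thesis using v vF xv by blast
      qed
    qed
    then obtain v where v: "v \<in> F" "free_at ed J c v b" "x \<notin> kempe_comp ed J c a b v"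
      "(y0, v) \<in> {(u, w) \<in> R. \<not> (u \<in> kempe_comp ed J c a b v \<and> free_at ed J c u b)}\<^sup>*" by blast
    define c1 where "c1 = kempe_swap ed J c a b v"
    \<comment> \<open>The spoke \<open>xw\<close> keeps its color because its end \<open>x\<close>
      is outside the component. If \<open>u\<close> is inside, that color is not \<open>a\<close>,
      which is missing at \<open>x\<close>, nor \<open>b\<close>, which is present at
      \<open>u\<close>; so it is still missing at \<open>u\<close> after the swap.\<close>
    have "{(u, w) \<in> R. \<not> (u \<in> kempe_comp ed J c a b v \<and> free_at ed J c u b)} \<subseteq> fan_rel ed J c1 x"
    proof (clarify)
      fix u w assume uw: "(u, w) \<in> R" "\<not> (u \<in> kempe_comp ed J c a b v \<and> free_at ed J c u b)"
      then obtain j where j: "j \<in> J" "ed j = {x, w}" "free_at ed J c u (c j)"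
        by (auto simp: R_def fan_rel_def)
      have c1j: "c1 j = c j"
        unfolding c1_def using kempe_swap_outside[OF v(3) cJ] j by auto
      have "free_at ed J c1 u (c j)"
      proof (cases "u \<in> kempe_comp ed J c a b v")
        case True
        then have "c j \<noteq> b" using uw j by auto
        moreover have "c j \<noteq> a" using a(2) j by (auto simp: free_at_def)
        ultimately have "swap_col a b (c j) = c j" by (simp add: swap_col_def)
        then show ?thesis
          using free_at_kempe_swap_inside[OF True, of "c j"] j(3) by (simp add: c1_def)
      qed (use free_at_kempe_swap_outside[OF _ cJ] j in \<open>simp add: c1_def\<close>)
      then show "(u, w) \<in> fan_rel ed J c1 x"
        using j c1j unfolding fan_rel_def by force
    qed
    then have "(y0, v) \<in> (fan_rel ed J c1 x)\<^sup>*" using v(4) rtrancl_mono by blast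
    moreover have "free_at ed J c1 x a"
      using free_at_kempe_swap_outside[OF v(3) cJ] a by (simp add: c1_def)
    moreover have "free_at ed J c1 v a"
      using free_at_kempe_swap_inside[OF kempe_comp_self, of ed J c a b v b] v anb
      by (simp add: c1_def swap_col_def)
    moreover have "proper_on ed J c1"
      unfolding c1_def by (rule proper_on_kempe_swap[OF proper cJ])
    moreover have "\<forall>j. c1 j \<le> r"
      unfolding c1_def by (intro allI kempe_swap_le[OF a(1) b(1) le])
    ultimately obtain c' where c': "proper_on ed (insert e J) c'" "\<forall>j. c' j \<le> r"
        "\<forall>j. c' j \<noteq> c1 j \<longrightarrow> j \<in> insert e J \<and> x \<in> ed j"
      using shift[of v c1 a] a(1) by auto
    have "v \<in> \<Union> (ed ` insert e J)"
    proof -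
      have "(y0, v) \<in> R\<^sup>*" using v(1) by (simp add: F_def)
      then show ?thesis using xy(1) by (cases rule: rtranclE) (auto simp: R_def fan_rel_def)
    qed
    with a(1) b(1) c' show ?thesis
      unfolding c1_def by - (rule exI[of _ a], rule exI[of _ b], rule exI[of _ v],
        rule exI[of _ c'], rule exI[of _ x], intro conjI)
  qed
qed

section \<open>Loop programs\<close>

text \<open>
  All loops are counting loops whose bound is a constant or one of the inputs \<open>n\<close>, \<open>m\<close>. So programs
  denote total functions on states, and a polynomial time bound can be read off their syntax.
\<close>

datatype prog =
    Nop
  | Asg bank aexp aexp
  | Sq prog prog
  | Cnd bexp prog prog
  | Loop bank aexp prog

definition set_var :: "bank \<Rightarrow> nat \<Rightarrow> state \<Rightarrow> state" where
  "set_var x k s = s(x := (s x)(0 := k))"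

text \<open>After a loop the counter holds the bound, as it does when the compiled while loop exits;
  this makes the two final states equal and not merely similar.\<close>

primrec den :: "prog \<Rightarrow> state \<Rightarrow> state" where
  "den Nop = (\<lambda>s. s)"
| "den (Asg x i a) = (\<lambda>s. s(x := (s x)(aval i s := aval a s)))"
| "den (Sq p q) = (\<lambda>s. den q (den p s))"
| "den (Cnd b p q) = (\<lambda>s. if bval b s then den p s else den q s)"
| "den (Loop x b p) =
     (\<lambda>s. set_var x (aval b s) (fold (\<lambda>j t. den p (set_var x j t)) [0..<aval b s] s))"

abbreviation Var :: "bank \<Rightarrow> aexp" where
  "Var x \<equiv> Cell x (Const 0)"

primrec compile :: "prog \<Rightarrow> com" where
  "compile Nop = Skip"
| "compile (Asg x i a) = Store x i a"
| "compile (Sq p q) = Seq (compile p) (compile q)"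
| "compile (Cnd b p q) = If b (compile p) (compile q)"
| "compile (Loop x b p) =
     Seq (Store x (Const 0) (Const 0))
       (While (Less (Var x) b) (Seq (compile p) (Store x (Const 0) (Add (Var x) (Const 1)))))"

primrec writes :: "prog \<Rightarrow> bank set" where
  "writes Nop = {}"
| "writes (Asg x i a) = {x}"
| "writes (Sq p q) = writes p \<union> writes q"
| "writes (Cnd b p q) = writes p \<union> writes q"
| "writes (Loop x b p) = insert x (writes p)"

definition loop_bound :: "aexp \<Rightarrow> bool" where
  "loop_bound b \<longleftrightarrow> (\<exists>k. b = Const k) \<or> b = Var ''n'' \<or> b = Var ''m''"

text \<open>Time polynomials are evaluated at \<open>n + m\<close>, so the polynomial
  \<open>[:0, 1:]\<close> bounds either input.\<close>

definition bound_poly :: "aexp \<Rightarrow> nat poly" where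
  "bound_poly b = (case b of Const k \<Rightarrow> [:k:] | _ \<Rightarrow> [:0, 1:])"

text \<open>\<open>den\<close> evaluates a loop bound once, the compiled while loop before every
  iteration. They agree because \<open>n\<close> and \<open>m\<close> are never written; and since
  the body does not write the counter, the increment leads to the next index.\<close>

primrec wf_prog :: "prog \<Rightarrow> bool" where
  "wf_prog Nop = True"
| "wf_prog (Asg x i a) = (x \<noteq> ''n'' \<and> x \<noteq> ''m'')"
| "wf_prog (Sq p q) = (wf_prog p \<and> wf_prog q)"
| "wf_prog (Cnd b p q) = (wf_prog p \<and> wf_prog q)"
| "wf_prog (Loop x b p) =
     (x \<noteq> ''n'' \<and> x \<noteq> ''m'' \<and> x \<notin> writes p \<and> loop_bound b \<and> wf_prog p)"

text \<open>An iteration costs its body plus \<open>4 + acost b\<close> for the guard and 6 for the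
  increment. Initialization (3) and the final failing guard (\<open>4 + acost b\<close>) fit into
  the last summand.\<close>

primrec time_poly :: "prog \<Rightarrow> nat poly" where
  "time_poly Nop = [:1:]"
| "time_poly (Asg x i a) = [:1 + acost i + acost a:]"
| "time_poly (Sq p q) = time_poly p + time_poly q"
| "time_poly (Cnd b p q) = [:1 + bcost b:] + time_poly p + time_poly q"
| "time_poly (Loop x b p) = bound_poly b * (time_poly p + [:10 + acost b:]) + [:10 + acost b:]"

declare den.simps(5) [simp del]

lemma set_var_simps [simp]:
  "set_var x k s x 0 = k"
  "y \<noteq> x \<Longrightarrow> set_var x k s y = s y"
  "i \<noteq> 0 \<Longrightarrow> set_var x k s x i = s x i"
  "set_var x k (set_var x l s) = set_var x k s"
  by (simp_all add: set_var_def)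

section \<open>Compilation with a polynomial time bound\<close>

lemma den_frame: "y \<notin> writes p \<Longrightarrow> den p s y = s y"
proof (induction p arbitrary: s)
  case (Loop x b p)
  have "fold (\<lambda>j t. den p (set_var x j t)) js s y = s y" for js
    using Loop by (induction js arbitrary: s) auto
  then show ?case using Loop by (simp add: den.simps(5))
qed auto

lemma wf_prog_writes: "wf_prog p \<Longrightarrow> ''n'' \<notin> writes p \<and> ''m'' \<notin> writes p"
  by (induction p) auto

lemma loop_bound_aval:
  assumes "loop_bound b" "t ''n'' = s ''n''" "t ''m'' = s ''m''"
  shows "aval b t = aval b s" "aval b s \<le> poly (bound_poly b) (s ''n'' 0 + s ''m'' 0)"
  using assms by (auto simp: loop_bound_def bound_poly_def)

lemma exec_compile:
  assumes "wf_prog p"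
  shows "\<exists>t. exec (compile p) s t (den p s) \<and> t \<le> poly (time_poly p) (s ''n'' 0 + s ''m'' 0)"
  using assms
proof (induction p arbitrary: s)
  case Nop
  show ?case using exec.Skip by (intro exI[of _ 1]) simp
next
  case (Asg x i a)
  have "exec (compile (Asg x i a)) s (1 + acost i + acost a) (den (Asg x i a) s)"
    unfolding compile.simps den.simps by (rule exec.Store)
  moreover have "1 + acost i + acost a \<le> poly (time_poly (Asg x i a)) (s ''n'' 0 + s ''m'' 0)" by simp
  ultimately show ?case by blast
next
  case (Sq p q)
  from Sq obtain t where t: "exec (compile p) s t (den p s)"
    "t \<le> poly (time_poly p) (s ''n'' 0 + s ''m'' 0)" by fastforce
  from Sq obtain u where u: "exec (compile q) (den p s) u (den q (den p s))"
    "u \<le> poly (time_poly q) (den p s ''n'' 0 + den p s ''m'' 0)" by fastforce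
  have "den p s ''n'' = s ''n''" "den p s ''m'' = s ''m''"
    using wf_prog_writes Sq.prems by (auto intro!: den_frame)
  then show ?case using t u exec.Seq[OF t(1) u(1)] by (intro exI[of _ "t + u"]) simp
next
  case (Cnd b p q)
  show ?case
  proof (cases "bval b s")
    case True
    obtain t where "exec (compile p) s t (den p s)"
      "t \<le> poly (time_poly p) (s ''n'' 0 + s ''m'' 0)" using Cnd by fastforce
    then show ?thesis using exec.IfTrue[of b s, OF True, of "compile p" t "den p s" "compile q"] True
      by (intro exI[of _ "1 + bcost b + t"]) simp
  next
    case False
    obtain t where "exec (compile q) s t (den q s)"
      "t \<le> poly (time_poly q) (s ''n'' 0 + s ''m'' 0)" using Cnd by fastforce
    then show ?thesis using exec.IfFalse[of b s, OF False, of "compile q" t "den q s" "compile p"] False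
      by (intro exI[of _ "1 + bcost b + t"]) simp
  qed
next
  case (Loop x b p)
  define N where "N = aval b s"
  define st where "st j = fold (\<lambda>j t. den p (set_var x j t)) [0..<j] s" for j
  define T where "T = poly (time_poly p) (s ''n'' 0 + s ''m'' 0)"
  have nx: "x \<noteq> ''n''" "x \<noteq> ''m''" "x \<notin> writes p" "loop_bound b" "wf_prog p"
    using Loop.prems by auto
  have step: "st (Suc j) = den p (set_var x j (st j))" for j
    by (simp add: st_def)
  have fr: "st j ''n'' = s ''n'' \<and> st j ''m'' = s ''m''" for j
  proof (induction j)
    case (Suc j)
    then show ?case using nx wf_prog_writes[of p] by (simp add: step den_frame)
  qed (simp add: st_def)
  have av: "aval b (set_var x j (st k)) = N" for j k
    unfolding N_def using fr[of k] nx by (intro loop_bound_aval) auto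
  let ?W = "While (Less (Var x) b) (Seq (compile p) (Store x (Const 0) (Add (Var x) (Const 1))))"
  \<comment> \<open>\<open>exec\<close> unrolls a while loop from the front while
    \<open>fold\<close> adds iterations at the back; induction on the number \<open>d\<close> of
    iterations still to come reconciles the two.\<close>
  have main: "\<exists>t. exec ?W (set_var x (N - d) (st (N - d))) t (set_var x N (st N)) \<and>
      t \<le> d * (T + (10 + acost b)) + (4 + acost b)" if "d \<le> N" for d
    using that
  proof (induction d)
    case 0
    have "\<not> bval (Less (Var x) b) (set_var x N (st N))" by (simp add: av)
    from exec.WhileFalse[OF this] show ?case by fastforce
  next
    case (Suc d)
    let ?j = "N - Suc d"
    have j: "Suc ?j = N - d" "?j < N" using Suc.prems by auto
    let ?s1 = "set_var x ?j (st ?j)"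
    have 1: "bval (Less (Var x) b) ?s1" using j by (simp add: av)
    obtain t where t: "exec (compile p) ?s1 t (st (N - d))" "t \<le> T"
      using Loop.IH[OF nx(5), of ?s1] fr[of ?j] nx step[of ?j] j by (auto simp: T_def)
    have "st (N - d) x = ?s1 x"
      using den_frame[OF nx(3), of ?s1] step[of ?j] j by simp
    then have x: "st (N - d) x 0 = ?j" by simp
    have "exec (Store x (Const 0) (Add (Var x) (Const 1))) (st (N - d)) 6
        (set_var x (N - d) (st (N - d)))"
    proof -
      have "aval (Add (Var x) (Const 1)) (st (N - d)) = N - d" "aval (Const 0) (st (N - d)) = 0"
        "1 + acost (Const 0) + acost (Add (Var x) (Const 1)) = 6"
        using x j by simp_all
      then show ?thesis
        using exec.Store[of x "Const 0" "Add (Var x) (Const 1)" "st (N - d)"]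
        by (simp only: set_var_def)
    qed
    from exec.Seq[OF t(1) this]
    have 2: "exec (Seq (compile p) (Store x (Const 0) (Add (Var x) (Const 1)))) ?s1 (t + 6)
        (set_var x (N - d) (st (N - d)))" .
    obtain u where u: "exec ?W (set_var x (N - d) (st (N - d))) u (set_var x N (st N))"
        "u \<le> d * (T + (10 + acost b)) + (4 + acost b)" using Suc by auto
    from exec.WhileTrue[OF 1 2 u(1)] u(2) t(2) show ?case
      by (intro exI[of _ "1 + bcost (Less (Var x) b) + (t + 6) + u"]) simp
  qed
  obtain t where t: "exec ?W (set_var x 0 s) t (set_var x N (st N))"
      "t \<le> N * (T + (10 + acost b)) + (4 + acost b)"
    using main[of N] by (auto simp: st_def)
  have "exec (Store x (Const 0) (Const 0)) s 3 (set_var x 0 s)"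
    using exec.Store[of x "Const 0" "Const 0" s] by (simp add: set_var_def numeral_3_eq_3)
  from exec.Seq[OF this t(1)]
  have "exec (compile (Loop x b p)) s (3 + t) (den (Loop x b p) s)"
    by (simp add: N_def st_def den.simps(5))
  moreover have "3 + t \<le> poly (time_poly (Loop x b p)) (s ''n'' 0 + s ''m'' 0)"
  proof -
    have "N * (T + (10 + acost b)) \<le> poly (bound_poly b) (s ''n'' 0 + s ''m'' 0) * (T + (10 + acost b))"
      using loop_bound_aval(2)[OF nx(4), of s s] by (intro mult_right_mono) (auto simp: N_def)
    moreover have "poly (time_poly (Loop x b p)) (s ''n'' 0 + s ''m'' 0) =
        poly (bound_poly b) (s ''n'' 0 + s ''m'' 0) * (T + (10 + acost b)) + (10 + acost b)"
      by (simp add: T_def)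
    ultimately show ?thesis using t(2) by linarith
  qed
  ultimately show ?case by blast
qed

text \<open>The counter is overwritten before each iteration and after the last one, so the
  invariant has to be insensitive to it. In exchange the body may assume its value and that all
  banks the loop does not write are still as in \<open>s\<close>.\<close>

lemma den_Loop_invariant:
  assumes "I 0 s" "\<And>j k t. I j t \<Longrightarrow> I j (set_var x k t)"
    and "\<And>j t. j < aval b s \<Longrightarrow> (\<And>y. y \<noteq> x \<Longrightarrow> y \<notin> writes p \<Longrightarrow> t y = s y) \<Longrightarrow> t x 0 = j \<Longrightarrow> I j t \<Longrightarrow>
           I (Suc j) (den p t)"
  shows "I (aval b s) (den (Loop x b p) s)"
proof -
  let ?f = "\<lambda>k. fold (\<lambda>j t. den p (set_var x j t)) [0..<k] s"
  have fr: "?f k y = s y" if "y \<noteq> x" "y \<notin> writes p" for k y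
    using that by (induction k) (auto simp: den_frame)
  have "k \<le> aval b s \<Longrightarrow> I k (?f k)" for k
  proof (induction k)
    case (Suc k)
    have "I (Suc k) (den p (set_var x k (?f k)))"
      by (rule assms(3)) (use Suc fr assms(2) in auto)
    then show ?case by simp
  qed (use assms(1) in simp)
  then show ?thesis using assms(2) by (simp add: den.simps(5))
qed

section \<open>Exhaustive recoloring\<close>

definition Or :: "bexp \<Rightarrow> bexp \<Rightarrow> bexp" where
  "Or b c = Neg (Conj (Neg b) (Neg c))"

lemma bval_Or [simp]: "bval (Or b c) s \<longleftrightarrow> bval b s \<or> bval c s"
  by (simp add: Or_def)

definition ends :: "state \<Rightarrow> nat \<Rightarrow> nat set" where
  "ends s j = {s ''src'' j, s ''dst'' j}"

text \<open>In round \<open>i\<close> the edges below \<open>i\<close> are already colored and edge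
  \<open>i\<close> is being added, hence the non-strict comparison.\<close>

definition active :: "state \<Rightarrow> nat set" where
  "active s = {j. j < s ''m'' 0 \<and> j \<le> s ''i'' 0}"

lemma ends_cong: "t ''src'' = s ''src'' \<Longrightarrow> t ''dst'' = s ''dst'' \<Longrightarrow> ends t = ends s"
  by (simp add: ends_def fun_eq_iff)

lemma active_cong: "t ''m'' = s ''m'' \<Longrightarrow> t ''i'' = s ''i'' \<Longrightarrow> active t = active s"
  by (simp add: active_def)

definition clash :: bexp where
  "clash = Conj (Conj (Neg (Less (Var ''i'') (Var ''p''))) (Neg (Less (Var ''i'') (Var ''q''))))
     (Conj (Neg (Equal (Var ''p'') (Var ''q'')))
       (Conj (Equal (Cell ''col'' (Var ''p'')) (Cell ''col'' (Var ''q'')))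
         (Or (Or (Equal (Cell ''src'' (Var ''p'')) (Cell ''src'' (Var ''q'')))
                 (Equal (Cell ''src'' (Var ''p'')) (Cell ''dst'' (Var ''q''))))
             (Or (Equal (Cell ''dst'' (Var ''p'')) (Cell ''src'' (Var ''q'')))
                 (Equal (Cell ''dst'' (Var ''p'')) (Cell ''dst'' (Var ''q'')))))))"

definition test :: prog where
  "test = Sq (Asg ''ok'' (Const 0) (Const 1))
     (Loop ''p'' (Var ''m'') (Loop ''q'' (Var ''m'') (Cnd clash (Asg ''ok'' (Const 0) (Const 0)) Nop)))"

lemma bval_clash:
  "bval clash s \<longleftrightarrow> s ''p'' 0 \<le> s ''i'' 0 \<and> s ''q'' 0 \<le> s ''i'' 0 \<and> s ''p'' 0 \<noteq> s ''q'' 0 \<and>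
     s ''col'' (s ''p'' 0) = s ''col'' (s ''q'' 0) \<and> ends s (s ''p'' 0) \<inter> ends s (s ''q'' 0) \<noteq> {}"
  by (auto simp: clash_def ends_def)

lemma writes_test: "writes test = {''ok'', ''p'', ''q''}"
  by (auto simp: test_def)

lemma wf_test: "wf_prog test"
  by (simp add: test_def loop_bound_def)

lemma den_test:
  "den test s ''ok'' 0 = (if proper_on (ends s) (active s) (s ''col'') then 1 else 0)"
proof -
  define m where "m = s ''m'' 0"
  \<comment> \<open>This is \<open>clash\<close> read in the initial state: of the banks it reads,
    the loops write only their own counters.\<close>
  define B where "B p q \<longleftrightarrow> p \<le> s ''i'' 0 \<and> q \<le> s ''i'' 0 \<and> p \<noteq> q \<and> s ''col'' p = s ''col'' q \<and>
      ends s p \<inter> ends s q \<noteq> {}" for p q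
  let ?c = "Cnd clash (Asg ''ok'' (Const 0) (Const 0)) Nop"
  let ?in = "Loop ''q'' (Var ''m'') ?c"
  define s1 where "s1 = den (Asg ''ok'' (Const 0) (Const 1)) s"
  have inner: "den ?in t ''ok'' 0 =
      (if t ''ok'' 0 = 1 \<and> (\<forall>q<m. \<not> B p q) then 1 else 0)"
    if t: "\<And>y. y \<notin> {''ok'', ''p'', ''q''} \<Longrightarrow> t y = s y" "t ''p'' 0 = p" "t ''ok'' 0 \<le> 1" for t p
  proof -
    have "t ''m'' 0 = m" using t(1) by (simp add: m_def)
    have "(\<lambda>j u. u ''ok'' 0 = (if t ''ok'' 0 = 1 \<and> (\<forall>q<j. \<not> B p q) then 1 else 0)) (aval (Var ''m'') t)
      (den ?in t)"
    proof (rule den_Loop_invariant)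
      fix j u assume j: "j < aval (Var ''m'') t"
        and fr: "\<And>y. y \<noteq> ''q'' \<Longrightarrow> y \<notin> writes ?c \<Longrightarrow> u y = t y"
        and u: "u ''q'' 0 = j" "u ''ok'' 0 = (if t ''ok'' 0 = 1 \<and> (\<forall>q<j. \<not> B p q) then 1 else 0)"
      have "ends u = ends s" using fr t(1) by (intro ends_cong) simp_all
      then have "bval clash u \<longleftrightarrow> B p j"
        unfolding bval_clash B_def using fr t u(1) by simp
      then show "den ?c u ''ok'' 0 = (if t ''ok'' 0 = 1 \<and> (\<forall>q<Suc j. \<not> B p q) then 1 else 0)"
        using u(2) by (auto simp: less_Suc_eq)
    qed (use t in auto)
    then show ?thesis using \<open>t ''m'' 0 = m\<close> by simp
  qed
  have "(\<lambda>j u. u ''ok'' 0 = (if \<forall>p<j. \<forall>q<m. \<not> B p q then 1 else 0)) (aval (Var ''m'') s1)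
      (den (Loop ''p'' (Var ''m'') ?in) s1)"
  proof (rule den_Loop_invariant)
    fix j u assume j: "j < aval (Var ''m'') s1"
        and fr: "\<And>y. y \<noteq> ''p'' \<Longrightarrow> y \<notin> writes ?in \<Longrightarrow> u y = s1 y"
        and u: "u ''p'' 0 = j" "u ''ok'' 0 = (if \<forall>p<j. \<forall>q<m. \<not> B p q then 1 else 0)"
    have "den ?in u ''ok'' 0 = (if u ''ok'' 0 = 1 \<and> (\<forall>q<m. \<not> B j q) then 1 else 0)"
      using fr u by (intro inner) (auto simp: s1_def)
    then show "den ?in u ''ok'' 0 = (if \<forall>p<Suc j. \<forall>q<m. \<not> B p q then 1 else 0)"
      using u(2) by (auto simp: less_Suc_eq)
  qed (auto simp: s1_def)
  then have "den test s ''ok'' 0 = (if \<forall>p<m. \<forall>q<m. \<not> B p q then 1 else 0)"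
    by (simp add: test_def s1_def m_def)
  moreover have "proper_on (ends s) (active s) (s ''col'') \<longleftrightarrow> (\<forall>p<m. \<forall>q<m. \<not> B p q)"
    unfolding proper_on_def active_def B_def m_def by auto
  ultimately show ?thesis by simp
qed

text \<open>Backtracking: as long as no witness for \<open>W\<close> has been met, \<open>ok\<close> is 0 and the bank \<open>col\<close>
  satisfies \<open>Inv\<close>; afterwards \<open>ok\<close> is 1 and \<open>col\<close> satisfies \<open>Good\<close> and is left alone.\<close>

definition seeks :: "((nat \<Rightarrow> nat) \<Rightarrow> bool) \<Rightarrow> ((nat \<Rightarrow> nat) \<Rightarrow> bool) \<Rightarrow> bool \<Rightarrow> prog \<Rightarrow> state \<Rightarrow> bool" where
  "seeks Inv Good W p s \<longleftrightarrow>
     (s ''ok'' 0 = 1 \<and> Good (s ''col'') \<longrightarrow> den p s ''ok'' 0 = 1 \<and> Good (den p s ''col'')) \<and>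
     (s ''ok'' 0 = 0 \<and> Inv (s ''col'') \<longrightarrow>
        den p s ''ok'' 0 = 1 \<and> Good (den p s ''col'') \<or>
        den p s ''ok'' 0 = 0 \<and> Inv (den p s ''col'') \<and> \<not> W)"

text \<open>Once an iteration succeeds, the remaining ones preserve the success; if none succeeds,
  each has refuted its own \<open>W j\<close> and together they refute the disjunction.\<close>

lemma seeks_Loop:
  assumes "x \<noteq> ''ok''" "x \<noteq> ''col''"
    and "\<And>j t. j < aval b s \<Longrightarrow> (\<And>y. y \<noteq> x \<Longrightarrow> y \<notin> writes p \<Longrightarrow> t y = s y) \<Longrightarrow> t x 0 = j \<Longrightarrow>
           seeks Inv Good (W j) p t"
  shows "seeks Inv Good (\<exists>j<aval b s. W j) (Loop x b p) s"
  unfolding seeks_def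
proof (rule conjI; rule impI)
  assume s: "s ''ok'' 0 = 1 \<and> Good (s ''col'')"
  show "den (Loop x b p) s ''ok'' 0 = 1 \<and> Good (den (Loop x b p) s ''col'')"
    by (rule den_Loop_invariant[of "\<lambda>j t. t ''ok'' 0 = 1 \<and> Good (t ''col'')"])
      (use s assms in \<open>auto simp: seeks_def\<close>)
next
  assume s: "s ''ok'' 0 = 0 \<and> Inv (s ''col'')"
  have "(\<lambda>j t. t ''ok'' 0 = 1 \<and> Good (t ''col'') \<or> t ''ok'' 0 = 0 \<and> Inv (t ''col'') \<and> \<not> (\<exists>k<j. W k))
     (aval b s) (den (Loop x b p) s)"
  proof (rule den_Loop_invariant)
    fix j t assume j: "j < aval b s" "\<And>y. y \<noteq> x \<Longrightarrow> y \<notin> writes p \<Longrightarrow> t y = s y" "t x 0 = j"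
      "t ''ok'' 0 = 1 \<and> Good (t ''col'') \<or> t ''ok'' 0 = 0 \<and> Inv (t ''col'') \<and> \<not> (\<exists>k<j. W k)"
    have "seeks Inv Good (W j) p t"
    proof (rule assms(3))
      show "t y = s y" if "y \<noteq> x" "y \<notin> writes p" for y using that by (rule j(2))
    qed (rule j(1), rule j(3))
    then show "den p t ''ok'' 0 = 1 \<and> Good (den p t ''col'') \<or>
        den p t ''ok'' 0 = 0 \<and> Inv (den p t ''col'') \<and> \<not> (\<exists>k<Suc j. W k)"
      using j(4) by (auto simp: seeks_def less_Suc_eq)
  qed (use s assms in auto)
  then show "den (Loop x b p) s ''ok'' 0 = 1 \<and> Good (den (Loop x b p) s ''col'') \<or>
      den (Loop x b p) s ''ok'' 0 = 0 \<and> Inv (den (Loop x b p) s ''col'') \<and> \<not> (\<exists>j<aval b s. W j)"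
    by simp
qed

section \<open>Search over a bounded number of recolored edges\<close>

abbreviation unless_ok :: "prog \<Rightarrow> prog" where
  "unless_ok p \<equiv> Cnd (Equal (Var ''ok'') (Const 0)) p Nop"

lemma seeks_unless_ok:
  assumes "s ''ok'' 0 = 0 \<Longrightarrow> Inv (s ''col'') \<Longrightarrow>
        den p s ''ok'' 0 = 1 \<and> Good (den p s ''col'') \<or>
        den p s ''ok'' 0 = 0 \<and> Inv (den p s ''col'') \<and> \<not> W"
  shows "seeks Inv Good W (unless_ok p) s"
  using assms by (auto simp: seeks_def)

text \<open>Every depth of the nested search needs counters and a saved color of its own. Unary
  names keep the depths apart by length, and apart from other banks by the first letter.\<close>

definition indexed :: "char \<Rightarrow> nat \<Rightarrow> bank" where
  "indexed c k = c # replicate k c"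

lemma indexed_eq_iff [simp]: "indexed c k = indexed d l \<longleftrightarrow> c = d \<and> k = l"
proof
  assume h: "indexed c k = indexed d l"
  from arg_cong[OF h, of length] h show "c = d \<and> k = l" by (simp add: indexed_def)
qed simp

lemma indexed_neq_Cons [simp]:
  "c \<noteq> d \<Longrightarrow> indexed c k \<noteq> d # w"
  "c \<noteq> d \<Longrightarrow> d # w \<noteq> indexed c k"
  by (simp_all add: indexed_def)

text \<open>Each level tries all \<open>m * (r + 1)\<close> ways to write one cell and undoes a
  failed trial from the saved color. With depth \<open>k\<close> the test runs at most
  \<open>(m * (r + 1))^k\<close> times, which is polynomial because the depth used is the constant
  \<open>r\<close>.\<close>

primrec search :: "nat \<Rightarrow> nat \<Rightarrow> prog" where
  "search r 0 = test"
| "search r (Suc k) =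
     Loop (indexed CHR ''x'' k) (Var ''m'') (Loop (indexed CHR ''y'' k) (Const (Suc r)) (unless_ok
       (Sq (Asg (indexed CHR ''z'' k) (Const 0) (Cell ''col'' (Var (indexed CHR ''x'' k))))
       (Sq (Asg ''col'' (Var (indexed CHR ''x'' k)) (Var (indexed CHR ''y'' k)))
       (Sq (search r k)
       (unless_ok (Asg ''col'' (Var (indexed CHR ''x'' k)) (Var (indexed CHR ''z'' k)))))))))"

lemma writes_search:
  "writes (search r k) \<subseteq> {''ok'', ''p'', ''q'', ''col''} \<union>
     (\<Union>l<k. {indexed CHR ''x'' l, indexed CHR ''y'' l, indexed CHR ''z'' l})"
proof (induction k)
  case (Suc k)
  then show ?case by (auto simp: lessThan_Suc)
qed (simp add: writes_test)

lemma indexed_notin_writes_search: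
  "c \<in> {CHR ''x'', CHR ''y'', CHR ''z''} \<Longrightarrow> k \<le> l \<Longrightarrow> indexed c l \<notin> writes (search r k)"
  using writes_search[of r k] by auto

lemma notin_writes_search:
  "x \<in> {''src'', ''dst'', ''m'', ''n'', ''i'', ''v'', ''a'', ''b'', ''cur'', ''mark''} \<Longrightarrow> x \<notin> writes (search r k)"
  using writes_search[of r k] by auto

lemma wf_search: "wf_prog (search r k)"
  by (induction k) (auto simp: wf_test loop_bound_def indexed_notin_writes_search)

definition near_proper :: "nat \<Rightarrow> nat \<Rightarrow> state \<Rightarrow> (nat \<Rightarrow> nat) \<Rightarrow> bool" where
  "near_proper r k s c \<longleftrightarrow> (\<exists>c'. (\<forall>j. c' j \<le> r) \<and> proper_on (ends s) (active s) c' \<and>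
     {j. c' j \<noteq> c j} \<subseteq> {..<s ''m'' 0} \<and> card {j. c' j \<noteq> c j} \<le> k)"

lemma near_proper_cong:
  "t ''src'' = s ''src'' \<Longrightarrow> t ''dst'' = s ''dst'' \<Longrightarrow> t ''m'' = s ''m'' \<Longrightarrow> t ''i'' = s ''i'' \<Longrightarrow>
   near_proper r k t = near_proper r k s"
  by (intro ext) (simp only: near_proper_def ends_cong[of t s] active_cong[of t s])

lemma near_proper_0:
  assumes "near_proper r 0 s c"
  shows "proper_on (ends s) (active s) c"
proof -
  obtain c' where c': "proper_on (ends s) (active s) c'"
     "{j. c' j \<noteq> c j} \<subseteq> {..<s ''m'' 0}" "card {j. c' j \<noteq> c j} = 0"
    using assms by (auto simp: near_proper_def)
  then have "{j. c' j \<noteq> c j} = {}" using finite_subset by fastforce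
  then have "c' = c" by auto
  then show ?thesis using c' by simp
qed

text \<open>One wrong edge is corrected. If no edge is wrong, any edge is rewritten with its own
  color, so that searching with exactly \<open>k\<close> writes also covers fewer changes; this
  takes at least one edge.\<close>

lemma near_proper_Suc:
  assumes "near_proper r (Suc k) s c" "0 < s ''m'' 0"
  shows "\<exists>e<s ''m'' 0. \<exists>l<Suc r. near_proper r k s (c(e := l))"
proof -
  obtain c' where c': "\<forall>j. c' j \<le> r" "proper_on (ends s) (active s) c'"
     "{j. c' j \<noteq> c j} \<subseteq> {..<s ''m'' 0}" "card {j. c' j \<noteq> c j} \<le> Suc k"
    using assms by (auto simp: near_proper_def)
  \<comment> \<open>That removing \<open>e\<close> alters the set is a way to say that
    \<open>e\<close> belongs to it.\<close>
  have "\<exists>e<s ''m'' 0. {j. c' j \<noteq> c j} - {e} \<noteq> {j. c' j \<noteq> c j} \<or> {j. c' j \<noteq> c j} = {}"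
    using c'(3) assms(2) by blast
  then obtain e where em: "e < s ''m'' 0" and e: "e \<in> {j. c' j \<noteq> c j} \<or> {j. c' j \<noteq> c j} = {}"
    by blast
  have eq: "{j. c' j \<noteq> (c(e := c' e)) j} = {j. c' j \<noteq> c j} - {e}" by auto
  have "card ({j. c' j \<noteq> c j} - {e}) \<le> k"
    using e
  proof
    assume "e \<in> {j. c' j \<noteq> c j}"
    then show ?thesis using c'(4) card_Diff_singleton[of e "{j. c' j \<noteq> c j}"] by linarith
  qed simp
  then have "near_proper r k s (c(e := c' e))"
    unfolding near_proper_def
  proof (intro exI[of _ c'] conjI)
    show "{j. c' j \<noteq> (c(e := c' e)) j} \<subseteq> {..<s ''m'' 0}" unfolding eq using c'(3) by blast
    show "card {j. c' j \<noteq> (c(e := c' e)) j} \<le> k" unfolding eq by fact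
  qed (rule c'(1), rule c'(2))
  moreover have "c' e < Suc r" using c'(1) by (simp add: le_imp_less_Suc)
  ultimately show ?thesis using em by blast
qed

text \<open>A failure restores \<open>col\<close> exactly, so all candidates are tried on the same
  coloring. Completeness is \<open>near_proper_Suc\<close> read backwards: if no single write leads
  within reach of \<open>k\<close> further changes, then \<open>Suc k\<close> changes do not
  suffice.\<close>

lemma den_search:
  assumes "s ''ok'' 0 = 0" "\<forall>j. s ''col'' j \<le> r" "0 < s ''m'' 0"
  shows "den (search r k) s ''ok'' 0 = 1 \<and>
           proper_on (ends s) (active s) (den (search r k) s ''col'') \<and> (\<forall>j. den (search r k) s ''col'' j \<le> r) \<or>
         den (search r k) s ''ok'' 0 = 0 \<and> den (search r k) s ''col'' = s ''col'' \<and>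
           \<not> near_proper r k s (s ''col'')"
  using assms
proof (induction k arbitrary: s)
  case 0
  have "den test s ''col'' = s ''col''" by (simp add: den_frame writes_test)
  then show ?case using 0 near_proper_0[of r s "s ''col''"] by (auto simp: den_test)
next
  case (Suc k)
  let ?x = "indexed CHR ''x'' k" and ?y = "indexed CHR ''y'' k" and ?z = "indexed CHR ''z'' k"
  let ?Inv = "\<lambda>c. c = s ''col''"
  let ?Good = "\<lambda>c. proper_on (ends s) (active s) c \<and> (\<forall>j. c j \<le> r)"
  define body where "body = Sq (Asg ?z (Const 0) (Cell ''col'' (Var ?x)))
       (Sq (Asg ''col'' (Var ?x) (Var ?y))
       (Sq (search r k) (unless_ok (Asg ''col'' (Var ?x) (Var ?z)))))"
  have wb: "writes body = {?z, ''col''} \<union> writes (search r k)" by (auto simp: body_def)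
  have fixed: "t y = s y" if "\<And>w. w \<noteq> ?x \<Longrightarrow> w \<noteq> ?y \<Longrightarrow> w \<notin> writes body \<Longrightarrow> t w = s w"
    "y \<in> {''src'', ''dst'', ''m'', ''i''}" for t y
    using that notin_writes_search[of y r k] by (auto simp: wb)
  have body: "den body t ''ok'' 0 = 1 \<and> ?Good (den body t ''col'') \<or>
        den body t ''ok'' 0 = 0 \<and> ?Inv (den body t ''col'') \<and> \<not> near_proper r k s ((s ''col'')(e := l))"
    if t: "\<And>w. w \<noteq> ?x \<Longrightarrow> w \<noteq> ?y \<Longrightarrow> w \<notin> writes body \<Longrightarrow> t w = s w"
      "t ?x 0 = e" "t ?y 0 = l" "l < Suc r" "t ''ok'' 0 = 0" "t ''col'' = s ''col''" for t e l
  proof -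
    define t1 where "t1 = t(?z := (t ?z)(0 := t ''col'' e), ''col'' := (t ''col'')(e := l))"
    have t1: "t1 y = s y" if "y \<in> {''src'', ''dst'', ''m'', ''i''}" for y
      using fixed[OF t(1) that] that by (auto simp: t1_def)
    define t2 where "t2 = den (search r k) t1"
    have db: "den body t = den (unless_ok (Asg ''col'' (Var ?x) (Var ?z))) t2"
      using t by (simp add: body_def t1_def t2_def)
    have t1c: "t1 ''col'' = (s ''col'')(e := l)" using t by (simp add: t1_def)
    have fr: "t2 ?x = t ?x" "t2 ?z 0 = s ''col'' e"
      using t by (simp_all add: t2_def t1_def den_frame indexed_notin_writes_search)
    have en: "ends t1 = ends s" "active t1 = active s"
      by (rule ends_cong active_cong; simp add: t1)+
    have np: "near_proper r k t1 = near_proper r k s"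
      by (rule near_proper_cong) (simp_all add: t1)
    have p: "t1 ''ok'' 0 = 0" "\<forall>j. t1 ''col'' j \<le> r" "0 < t1 ''m'' 0"
      using Suc.prems t t1[of "''m''"] by (simp_all add: t1_def)
    have "t2 ''ok'' 0 = 1 \<and> ?Good (t2 ''col'') \<or>
         t2 ''ok'' 0 = 0 \<and> t2 ''col'' = t1 ''col'' \<and> \<not> near_proper r k s (t1 ''col'')"
      using Suc.IH[OF p] unfolding t2_def[symmetric] en np .
    then show ?thesis
    proof (elim disjE)
      assume h: "t2 ''ok'' 0 = 1 \<and> ?Good (t2 ''col'')"
      then have "den body t = t2" by (simp add: db)
      then show ?thesis using h by simp
    next
      assume h: "t2 ''ok'' 0 = 0 \<and> t2 ''col'' = t1 ''col'' \<and> \<not> near_proper r k s (t1 ''col'')"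
      then have "den body t = t2(''col'' := (t2 ''col'')(e := s ''col'' e))"
        using fr t(2) by (simp add: db)
      moreover have "(t2 ''col'')(e := s ''col'' e) = s ''col''"
        using h by (simp add: t1c)
      ultimately have "den body t ''ok'' 0 = 0" "den body t ''col'' = s ''col''"
        using h by simp_all
      moreover have "\<not> near_proper r k s ((s ''col'')(e := l))" using h by (simp only: t1c) simp
      ultimately show ?thesis by blast
    qed
  qed
  have "seeks ?Inv ?Good (\<exists>e<aval (Var ''m'') s. \<exists>l<Suc r. near_proper r k s ((s ''col'')(e := l)))
      (search r (Suc k)) s"
    unfolding search.simps body_def[symmetric]
  proof (rule seeks_Loop)
    fix e t assume t: "\<And>w. w \<noteq> ?x \<Longrightarrow> w \<notin> writes (Loop ?y (Const (Suc r)) (unless_ok body)) \<Longrightarrow> t w = s w"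
      "t ?x 0 = e"
    have "seeks ?Inv ?Good (\<exists>l<aval (Const (Suc r)) t. near_proper r k s ((s ''col'')(e := l)))
        (Loop ?y (Const (Suc r)) (unless_ok body)) t"
    proof (rule seeks_Loop)
      fix l u assume u: "l < aval (Const (Suc r)) t"
        "\<And>w. w \<noteq> ?y \<Longrightarrow> w \<notin> writes (unless_ok body) \<Longrightarrow> u w = t w" "u ?y 0 = l"
      have "?x \<notin> writes body" by (simp add: wb indexed_notin_writes_search)
      then have "u ?x 0 = e" using u(2)[of ?x] t(2) by simp
      then show "seeks ?Inv ?Good (near_proper r k s ((s ''col'')(e := l))) (unless_ok body) u"
        using u t by (intro seeks_unless_ok body) auto
    qed simp_all
    then show "seeks ?Inv ?Good (\<exists>l<Suc r. near_proper r k s ((s ''col'')(e := l)))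
        (Loop ?y (Const (Suc r)) (unless_ok body)) t" by simp
  qed simp_all
  then show ?case
    using Suc.prems near_proper_Suc[of r k s "s ''col''"] by (auto simp: seeks_def)
qed

section \<open>Kempe swaps by marking a component\<close>

definition spread :: prog where
  "spread = Loop ''j'' (Var ''m'')
     (Cnd (Conj (Less (Var ''j'') (Var ''i''))
            (Conj (Or (Equal (Cell ''cur'' (Var ''j'')) (Var ''a'')) (Equal (Cell ''cur'' (Var ''j'')) (Var ''b'')))
               (Or (Equal (Cell ''mark'' (Cell ''src'' (Var ''j''))) (Const 1))
                   (Equal (Cell ''mark'' (Cell ''dst'' (Var ''j''))) (Const 1)))))
        (Sq (Asg ''mark'' (Cell ''src'' (Var ''j'')) (Const 1)) (Asg ''mark'' (Cell ''dst'' (Var ''j'')) (Const 1)))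
        Nop)"

text \<open>There are \<open>2 * m\<close> passes because reachability needs no walk longer than the
  number of ordered pairs in the relation, at most two per edge. The factor 2 becomes an inner loop
  since only constants, \<open>n\<close> and \<open>m\<close> may bound a loop.\<close>

definition mark_component :: prog where
  "mark_component =
     Sq (Loop ''j'' (Var ''n'') (Asg ''mark'' (Var ''j'') (Const 0)))
    (Sq (Asg ''mark'' (Var ''v'') (Const 1))
        (Loop ''p'' (Var ''m'') (Loop ''q'' (Const 2) spread)))"

text \<open>The swapped coloring goes to \<open>col\<close> and the source \<open>cur\<close> stays
  intact, so every vertex and color pair is tried on the same base coloring.\<close>

definition swap_marked :: prog where
  "swap_marked = Loop ''j'' (Var ''m'')
     (Sq (Asg ''col'' (Var ''j'') (Cell ''cur'' (Var ''j'')))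
         (Cnd (Conj (Less (Var ''j'') (Var ''i'')) (Equal (Cell ''mark'' (Cell ''src'' (Var ''j''))) (Const 1)))
           (Cnd (Equal (Cell ''cur'' (Var ''j'')) (Var ''a'')) (Asg ''col'' (Var ''j'') (Var ''b''))
             (Cnd (Equal (Cell ''cur'' (Var ''j'')) (Var ''b'')) (Asg ''col'' (Var ''j'') (Var ''a'')) Nop))
           Nop))"

lemma writes_spread: "writes spread = {''j'', ''mark''}"
  by (auto simp: spread_def)

lemma writes_mark_component: "writes mark_component = {''j'', ''p'', ''q'', ''mark''}"
  by (auto simp: mark_component_def writes_spread)

lemma writes_swap_marked: "writes swap_marked = {''j'', ''col''}"
  by (auto simp: swap_marked_def)

lemma wf_kempe: "wf_prog mark_component" "wf_prog swap_marked"
  by (auto simp: mark_component_def swap_marked_def spread_def loop_bound_def)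

definition marked :: "state \<Rightarrow> nat set" where
  "marked s = {u. u < s ''n'' 0 \<and> s ''mark'' u = 1}"

definition state_rel :: "state \<Rightarrow> (nat \<times> nat) set" where
  "state_rel s = kempe_rel (ends s) {..<s ''i'' 0} (s ''cur'') (s ''a'' 0) (s ''b'' 0)"

definition state_comp :: "state \<Rightarrow> nat set" where
  "state_comp s = kempe_comp (ends s) {..<s ''i'' 0} (s ''cur'') (s ''a'' 0) (s ''b'' 0) (s ''v'' 0)"

definition ends_in_range :: "state \<Rightarrow> bool" where
  "ends_in_range s \<longleftrightarrow> s ''i'' 0 \<le> s ''m'' 0 \<and> (\<forall>j<s ''m'' 0. s ''src'' j < s ''n'' 0 \<and> s ''dst'' j < s ''n'' 0)"

definition colored_ab :: "state \<Rightarrow> nat \<Rightarrow> bool" where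
  "colored_ab s j \<longleftrightarrow> j < s ''i'' 0 \<and> (s ''cur'' j = s ''a'' 0 \<or> s ''cur'' j = s ''b'' 0)"

lemma ends_subset_state_comp:
  assumes "colored_ab s j" "ends s j \<inter> state_comp s \<noteq> {}"
  shows "ends s j \<subseteq> state_comp s"
proof -
  have "(s ''src'' j, s ''dst'' j) \<in> state_rel s" "(s ''dst'' j, s ''src'' j) \<in> state_rel s"
    using assms(1) by (auto simp: state_rel_def kempe_rel_def ends_def colored_ab_def)
  then show ?thesis
    using assms(2) unfolding ends_def state_comp_def kempe_comp_def state_rel_def
    by (auto intro: rtrancl_into_rtrancl)
qed

lemma state_rel_colored_ab: "(u, w) \<in> state_rel s \<longleftrightarrow> (\<exists>j. colored_ab s j \<and> ends s j = {u, w})"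
  by (auto simp: state_rel_def kempe_rel_def colored_ab_def)

text \<open>Marks set early in a pass may propagate further within it, depending on the order of the
  edges. So a pass is only sandwiched: it adds at least one layer of neighbors and never leaves the
  component.\<close>

lemma den_spread:
  assumes s: "ends_in_range s" and fr: "\<And>y. y \<notin> {''j'', ''p'', ''q'', ''mark''} \<Longrightarrow> t y = s y"
    and sub: "marked t \<subseteq> state_comp s"
  shows "marked t \<union> state_rel s `` marked t \<subseteq> marked (den spread t)"
    "marked (den spread t) \<subseteq> state_comp s"
proof -
  let ?b = "Cnd (Conj (Less (Var ''j'') (Var ''i''))
            (Conj (Or (Equal (Cell ''cur'' (Var ''j'')) (Var ''a'')) (Equal (Cell ''cur'' (Var ''j'')) (Var ''b'')))
               (Or (Equal (Cell ''mark'' (Cell ''src'' (Var ''j''))) (Const 1))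
                   (Equal (Cell ''mark'' (Cell ''dst'' (Var ''j''))) (Const 1)))))
        (Sq (Asg ''mark'' (Cell ''src'' (Var ''j'')) (Const 1)) (Asg ''mark'' (Cell ''dst'' (Var ''j'')) (Const 1)))
        Nop"
  let ?I = "\<lambda>j u. marked t \<subseteq> marked u \<and> marked u \<subseteq> state_comp s \<and>
     (\<forall>l<j. colored_ab s l \<longrightarrow> ends s l \<inter> marked t \<noteq> {} \<longrightarrow> ends s l \<subseteq> marked u)"
  have mk: "marked (set_var ''j'' k u) = marked u" for k u
    by (simp add: marked_def)
  have main: "?I (aval (Var ''m'') t) (den spread t)"
    unfolding spread_def
  proof (rule den_Loop_invariant[where I = ?I])
    fix j u assume j: "j < aval (Var ''m'') t"
      and fr': "\<And>y. y \<noteq> ''j'' \<Longrightarrow> y \<notin> writes ?b \<Longrightarrow> u y = t y"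
      and uj: "u ''j'' 0 = j" and I: "?I j u"
    have u: "u y = s y" if "y \<notin> {''j'', ''p'', ''q'', ''mark''}" for y
      using fr[OF that] fr'[of y] that by auto
    have rng: "s ''src'' j < s ''n'' 0" "s ''dst'' j < s ''n'' 0"
      using s j fr[of "''m''"] by (auto simp: ends_in_range_def)
    define b where "b \<longleftrightarrow> colored_ab s j \<and> (u ''mark'' (s ''src'' j) = 1 \<or> u ''mark'' (s ''dst'' j) = 1)"
    have b: "b \<longleftrightarrow> colored_ab s j \<and> ends s j \<inter> marked u \<noteq> {}"
      using rng u[of "''n''"] by (auto simp: b_def ends_def marked_def)
    have den: "den ?b u = (if b then u(''mark'' := (u ''mark'')(s ''src'' j := 1, s ''dst'' j := 1)) else u)"
    proof -
      have cb: "bval (Conj (Less (Var ''j'') (Var ''i''))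
            (Conj (Or (Equal (Cell ''cur'' (Var ''j'')) (Var ''a'')) (Equal (Cell ''cur'' (Var ''j'')) (Var ''b'')))
               (Or (Equal (Cell ''mark'' (Cell ''src'' (Var ''j''))) (Const 1))
                   (Equal (Cell ''mark'' (Cell ''dst'' (Var ''j''))) (Const 1))))) u \<longleftrightarrow> b"
        unfolding b_def colored_ab_def using uj
        by (simp add: u[of "''i''"] u[of "''cur''"] u[of "''a''"] u[of "''b''"] u[of "''src''"] u[of "''dst''"])
      have "den (Sq (Asg ''mark'' (Cell ''src'' (Var ''j'')) (Const 1)) (Asg ''mark'' (Cell ''dst'' (Var ''j'')) (Const 1))) u
          = u(''mark'' := (u ''mark'')(s ''src'' j := 1, s ''dst'' j := 1))"
        using uj by (simp add: u[of "''src''"] u[of "''dst''"])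
      then show ?thesis by (simp only: den.simps(1,4) cb)
    qed
    have m: "marked (den ?b u) = (if b then marked u \<union> ends s j else marked u)"
      unfolding den using rng u[of "''n''"] by (auto simp: marked_def ends_def)
    show "?I (Suc j) (den ?b u)"
      unfolding m using I b ends_subset_state_comp[of s j]
      by (auto simp: less_Suc_eq)
  qed (use sub in \<open>simp_all add: mk\<close>)
  have "state_rel s `` marked t \<subseteq> marked (den spread t)"
  proof
    fix w assume "w \<in> state_rel s `` marked t"
    then obtain j u where j: "u \<in> marked t" "colored_ab s j" "ends s j = {u, w}"
      by (auto simp: state_rel_colored_ab)
    moreover have "j < s ''m'' 0" using j(2) s by (auto simp: colored_ab_def ends_in_range_def)
    ultimately show "w \<in> marked (den spread t)" using main fr[of "''m''"] by auto
  qed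
  then show "marked t \<union> state_rel s `` marked t \<subseteq> marked (den spread t)"
    "marked (den spread t) \<subseteq> state_comp s" using main by auto
qed

lemma card_state_rel: "finite (state_rel s)" "card (state_rel s) \<le> 2 * s ''i'' 0"
proof -
  let ?A = "(\<lambda>j. (s ''src'' j, s ''dst'' j)) ` {..<s ''i'' 0}"
  let ?B = "(\<lambda>j. (s ''dst'' j, s ''src'' j)) ` {..<s ''i'' 0}"
  have sub: "state_rel s \<subseteq> ?A \<union> ?B"
    by (auto simp: state_rel_colored_ab colored_ab_def ends_def doubleton_eq_iff)
  then show "finite (state_rel s)" by (rule finite_subset) simp
  have "card (state_rel s) \<le> card (?A \<union> ?B)" using sub by (intro card_mono) auto
  also have "\<dots> \<le> card ?A + card ?B" by (rule card_Un_le)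
  also have "\<dots> \<le> s ''i'' 0 + s ''i'' 0"
    by (intro add_mono card_image_le[THEN order_trans]) auto
  finally show "card (state_rel s) \<le> 2 * s ''i'' 0" by simp
qed

lemma marked_mark_component:
  assumes s: "ends_in_range s" "s ''v'' 0 < s ''n'' 0"
  shows "marked (den mark_component s) = state_comp s"
proof -
  let ?R = "state_rel s" and ?v = "s ''v'' 0"
  define s1 where "s1 = den (Loop ''j'' (Var ''n'') (Asg ''mark'' (Var ''j'') (Const 0))) s"
  define s2 where "s2 = den (Asg ''mark'' (Var ''v'') (Const 1)) s1"
  have fr2: "s2 y = s y" if "y \<notin> {''j'', ''p'', ''q'', ''mark''}" for y
    using that by (simp add: s2_def s1_def den_frame)
  have "\<forall>u<aval (Var ''n'') s. s1 ''mark'' u = 0"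
    unfolding s1_def
    by (rule den_Loop_invariant[where I = "\<lambda>j t. \<forall>u<j. t ''mark'' u = 0"]) (auto simp: less_Suc_eq)
  moreover have "s1 ''v'' = s ''v''" "s1 ''n'' = s ''n''" by (simp_all add: s1_def den_frame)
  ultimately have m2: "marked s2 = {?v}" using s(2) by (auto simp: marked_def s2_def)
  have vC: "?v \<in> state_comp s" by (simp add: state_comp_def kempe_comp_self)
  \<comment> \<open>After \<open>k\<close> passes everything reachable by a walk of length at most
    \<open>k\<close> is marked.\<close>
  let ?J = "\<lambda>k t. (\<forall>l\<le>k. (?R ^^ l) `` {?v} \<subseteq> marked t) \<and> marked t \<subseteq> state_comp s"
  have mk: "marked (set_var x k u) = marked u" if "x = ''p'' \<or> x = ''q''" for x k u
    using that by (auto simp: marked_def)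
  have sp: "?J (Suc k) (den spread t)"
    if "\<And>y. y \<notin> {''j'', ''p'', ''q'', ''mark''} \<Longrightarrow> t y = s y" "?J k t" for k t
  proof -
    note d = den_spread[OF s(1) that(1)]
    have "(?R ^^ l) `` {?v} \<subseteq> marked (den spread t)" if "l \<le> Suc k" for l
    proof (cases "l \<le> k")
      case True
      then show ?thesis using d(1) \<open>?J k t\<close> by blast
    next
      case False
      then have "l = Suc k" using that by simp
      then have "(?R ^^ l) `` {?v} = ?R `` ((?R ^^ k) `` {?v})" by (simp add: relcomp_Image)
      also have "\<dots> \<subseteq> ?R `` marked t" using \<open>?J k t\<close> by blast
      finally show ?thesis using d(1) \<open>?J k t\<close> by blast
    qed
    then show ?thesis using d(2) \<open>?J k t\<close> by blast
  qed
  let ?in = "Loop ''q'' (Const 2) spread"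
  define s3 where "s3 = den (Loop ''p'' (Var ''m'') ?in) s2"
  have "?J (2 * aval (Var ''m'') s2) s3"
    unfolding s3_def
  proof (rule den_Loop_invariant[where I = "\<lambda>k. ?J (2 * k)"])
    fix j t assume t: "\<And>y. y \<noteq> ''p'' \<Longrightarrow> y \<notin> writes ?in \<Longrightarrow> t y = s2 y" "?J (2 * j) t"
    have "(\<lambda>k. ?J (2 * j + k)) (aval (Const 2) t) (den ?in t)"
    proof (rule den_Loop_invariant[where I = "\<lambda>k. ?J (2 * j + k)"])
      fix k u assume u: "\<And>y. y \<noteq> ''q'' \<Longrightarrow> y \<notin> writes spread \<Longrightarrow> u y = t y" "?J (2 * j + k) u"
      have "u y = s y" if "y \<notin> {''j'', ''p'', ''q'', ''mark''}" for y
        using u(1)[of y] t(1)[of y] fr2[OF that] that by (simp add: writes_spread)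
      from sp[OF this u(2)] show "?J (2 * j + Suc k) (den spread u)" by simp
    qed (use t(2) in \<open>simp_all add: mk\<close>)
    then show "?J (2 * Suc j) (den ?in t)" by simp
  qed (use m2 vC in \<open>simp_all add: mk\<close>)
  then have J: "?J (2 * s ''m'' 0) s3" using fr2[of "''m''"] by simp
  have "state_comp s \<subseteq> marked s3"
  proof
    fix u assume "u \<in> state_comp s"
    then have "(?v, u) \<in> ?R\<^sup>*" by (simp add: state_comp_def kempe_comp_def state_rel_def)
    then obtain l where l: "l \<le> card ?R" "(?v, u) \<in> ?R ^^ l"
      unfolding rtrancl_finite_eq_relpow[OF card_state_rel(1)] by auto
    have "l \<le> 2 * s ''m'' 0"
      using l(1) card_state_rel(2)[of s] s(1) by (auto simp: ends_in_range_def)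
    then show "u \<in> marked s3" using J l(2) by blast
  qed
  moreover have "den mark_component s = s3"
    by (simp add: mark_component_def s1_def s2_def s3_def)
  ultimately show ?thesis using J by auto
qed

lemma den_swap_marked:
  assumes m: "marked s = state_comp s" and rng: "ends_in_range s"
  shows "den swap_marked s ''col'' = (\<lambda>j. if j < s ''m'' 0
     then kempe_swap (ends s) {..<s ''i'' 0} (s ''cur'') (s ''a'' 0) (s ''b'' 0) (s ''v'' 0) j
     else s ''col'' j)"
proof -
  let ?k = "kempe_swap (ends s) {..<s ''i'' 0} (s ''cur'') (s ''a'' 0) (s ''b'' 0) (s ''v'' 0)"
  let ?b = "Sq (Asg ''col'' (Var ''j'') (Cell ''cur'' (Var ''j'')))
         (Cnd (Conj (Less (Var ''j'') (Var ''i'')) (Equal (Cell ''mark'' (Cell ''src'' (Var ''j''))) (Const 1)))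
           (Cnd (Equal (Cell ''cur'' (Var ''j'')) (Var ''a'')) (Asg ''col'' (Var ''j'') (Var ''b''))
             (Cnd (Equal (Cell ''cur'' (Var ''j'')) (Var ''b'')) (Asg ''col'' (Var ''j'') (Var ''a'')) Nop))
           Nop)"
  have "den swap_marked s ''col'' = (\<lambda>l. if l < aval (Var ''m'') s then ?k l else s ''col'' l)"
    unfolding swap_marked_def
  proof (rule den_Loop_invariant[where I = "\<lambda>j t. t ''col'' = (\<lambda>l. if l < j then ?k l else s ''col'' l)"])
    fix j t assume j: "j < aval (Var ''m'') s"
      and fr: "\<And>y. y \<noteq> ''j'' \<Longrightarrow> y \<notin> writes ?b \<Longrightarrow> t y = s y"
      and tj: "t ''j'' 0 = j" and I: "t ''col'' = (\<lambda>l. if l < j then ?k l else s ''col'' l)"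
    have src: "s ''mark'' (s ''src'' j) = 1 \<longleftrightarrow> s ''src'' j \<in> state_comp s"
      using j rng by (auto simp: m[symmetric] marked_def ends_in_range_def)
    have k: "?k j = (if j < s ''i'' 0 \<and> ends s j \<inter> state_comp s \<noteq> {}
        then swap_col (s ''a'' 0) (s ''b'' 0) (s ''cur'' j) else s ''cur'' j)"
      by (simp add: kempe_swap_def state_comp_def)
    \<comment> \<open>The program inspects the source end only. For an edge colored \<open>a\<close>
      or \<open>b\<close> both ends lie in the component or neither does, and other colors are fixed
      by the swap anyway.\<close>
    have "s ''src'' j \<in> state_comp s" if "colored_ab s j" "ends s j \<inter> state_comp s \<noteq> {}"
      using ends_subset_state_comp[OF that] by (auto simp: ends_def)
    then have k': "?k j = (if j < s ''i'' 0 \<and> s ''mark'' (s ''src'' j) = 1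
        then swap_col (s ''a'' 0) (s ''b'' 0) (s ''cur'' j) else s ''cur'' j)"
      unfolding k src by (auto simp: swap_col_def colored_ab_def ends_def)
    have "den ?b t ''col'' = (t ''col'')(j := ?k j)"
      unfolding k' using fr tj by (simp add: swap_col_def)
    then show "den ?b t ''col'' = (\<lambda>l. if l < Suc j then ?k l else s ''col'' l)"
      by (auto simp: I fun_eq_iff less_Suc_eq)
  qed auto
  then show ?thesis by simp
qed

section \<open>The coloring algorithm\<close>

definition attempt :: "nat \<Rightarrow> prog" where
  "attempt r = Loop ''v'' (Var ''n'') (Loop ''a'' (Const (Suc r)) (Loop ''b'' (Const (Suc r))
     (unless_ok (Sq mark_component (Sq swap_marked (search r r))))))"

definition extend :: "nat \<Rightarrow> prog" where
  "extend r = Sq (Asg ''ok'' (Const 0) (Const 0)) (Sq (attempt r)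
     (Loop ''j'' (Var ''m'') (Asg ''cur'' (Var ''j'') (Cell ''col'' (Var ''j'')))))"

text \<open>\<open>s\<close> and \<open>t\<close> sum the colors \<open>c\<close> and the reversed
  colors \<open>r - c\<close>. The smaller version is written out, shifted by one to become
  positive; for the reversal this is \<open>Suc r - c\<close>.\<close>

definition finish :: "nat \<Rightarrow> prog" where
  "finish r = Sq (Asg ''s'' (Const 0) (Const 0)) (Sq (Asg ''t'' (Const 0) (Const 0))
     (Sq (Loop ''j'' (Var ''m'')
       (Sq (Asg ''s'' (Const 0) (Add (Var ''s'') (Cell ''cur'' (Var ''j''))))
           (Asg ''t'' (Const 0) (Add (Var ''t'') (Sub (Const r) (Cell ''cur'' (Var ''j'')))))))
     (Loop ''j'' (Var ''m'') (Cnd (Less (Var ''t'') (Var ''s''))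
       (Asg ''col'' (Var ''j'') (Sub (Const (Suc r)) (Cell ''cur'' (Var ''j''))))
       (Asg ''col'' (Var ''j'') (Add (Cell ''cur'' (Var ''j'')) (Const 1)))))))"

definition edge_coloring_prog :: "nat \<Rightarrow> prog" where
  "edge_coloring_prog r = Sq (Loop ''i'' (Var ''m'') (extend r)) (finish r)"

lemma writes_attempt:
  "writes (attempt r) = {''v'', ''a'', ''b'', ''j'', ''p'', ''q'', ''mark'', ''col''} \<union> writes (search r r)"
  by (auto simp: attempt_def writes_mark_component writes_swap_marked)

lemma writes_extend: "writes (extend r) = {''ok'', ''cur''} \<union> writes (attempt r)"
  by (auto simp: extend_def writes_attempt)

lemma wf_edge_coloring_prog: "wf_prog (edge_coloring_prog r)"
  by (simp add: edge_coloring_prog_def finish_def extend_def attempt_def wf_kempe wf_search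
      loop_bound_def writes_mark_component writes_swap_marked notin_writes_search)

text \<open>The setting of Vizing's theorem in array form: no loops, no parallel edges, maximum
  degree at most \<open>r\<close>.\<close>

definition bounded_degree_input :: "nat \<Rightarrow> state \<Rightarrow> bool" where
  "bounded_degree_input r s \<longleftrightarrow>
     (\<forall>j<s ''m'' 0. s ''src'' j < s ''n'' 0 \<and> s ''dst'' j < s ''n'' 0 \<and> s ''src'' j \<noteq> s ''dst'' j) \<and>
     inj_on (ends s) {..<s ''m'' 0} \<and> (\<forall>v. card {j. j < s ''m'' 0 \<and> v \<in> ends s j} \<le> r)"

lemma den_attempt:
  assumes s: "bounded_degree_input r s" "s ''i'' 0 < s ''m'' 0" "s ''ok'' 0 = 0"
    and le: "\<forall>j. s ''cur'' j \<le> r" "\<forall>j. s ''col'' j \<le> r"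
    and proper: "proper_on (ends s) {..<s ''i'' 0} (s ''cur'')"
  shows "proper_on (ends s) (active s) (den (attempt r) s ''col'')"
    "\<forall>j. den (attempt r) s ''col'' j \<le> r"
proof -
  let ?i = "s ''i'' 0" and ?m = "s ''m'' 0"
  \<comment> \<open>A bound on the colors is enough to keep between attempts:
    \<open>swap_marked\<close> rebuilds all cells of \<open>col\<close> below \<open>m\<close> from
    \<open>cur\<close>.\<close>
  let ?Inv = "\<lambda>c. \<forall>j. c j \<le> r"
  let ?Good = "\<lambda>c. proper_on (ends s) (active s) c \<and> (\<forall>j. c j \<le> r)"
  let ?ks = "\<lambda>v a b. kempe_swap (ends s) {..<?i} (s ''cur'') a b v"
  define W where "W v a b \<longleftrightarrow> (\<exists>c'. (\<forall>j. c' j \<le> r) \<and> proper_on (ends s) (active s) c' \<and>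
     card {j. j < ?m \<and> c' j \<noteq> ?ks v a b j} \<le> r)" for v a b
  have act: "active s = insert ?i {..<?i}" using s(2) by (auto simp: active_def)
  have rng: "ends_in_range s" using s by (auto simp: ends_in_range_def bounded_degree_input_def)
  have degm: "card {j. j < ?m \<and> v \<in> ends s j} \<le> r" for v
    using s(1) by (simp add: bounded_degree_input_def)
  have ex: "\<exists>v<s ''n'' 0. \<exists>a<Suc r. \<exists>b<Suc r. W v a b"
  proof -
    have sub: "insert ?i {..<?i} \<subseteq> {..<?m}" using s(2) by auto
    have "\<exists>a b v c' x. a \<le> r \<and> b \<le> r \<and> v \<in> \<Union> (ends s ` insert ?i {..<?i}) \<and>
           proper_on (ends s) (insert ?i {..<?i}) c' \<and> (\<forall>j. c' j \<le> r) \<and>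
           (\<forall>j. c' j \<noteq> ?ks v a b j \<longrightarrow> j \<in> insert ?i {..<?i} \<and> x \<in> ends s j)"
    proof (rule vizing_step)
      show "inj_on (ends s) (insert ?i {..<?i})"
        by (rule inj_on_subset[OF _ sub]) (use s(1) in \<open>simp add: bounded_degree_input_def\<close>)
      show "\<forall>j\<in>insert ?i {..<?i}. card (ends s j) = 2"
        using s(1) sub by (auto simp: bounded_degree_input_def ends_def)
      fix v
      have "card {j \<in> insert ?i {..<?i}. v \<in> ends s j} \<le> card {j. j < ?m \<and> v \<in> ends s j}"
        using sub by (intro card_mono) auto
      then show "card {j \<in> insert ?i {..<?i}. v \<in> ends s j} \<le> r"
        using degm[of v] by linarith
    qed (use proper le in auto)
    then obtain a b v c' x where c': "a \<le> r" "b \<le> r" "v \<in> \<Union> (ends s ` insert ?i {..<?i})"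
      "proper_on (ends s) (insert ?i {..<?i}) c'" "\<forall>j. c' j \<le> r"
      "\<forall>j. c' j \<noteq> ?ks v a b j \<longrightarrow> j \<in> insert ?i {..<?i} \<and> x \<in> ends s j" by blast
    \<comment> \<open>All edges that differ from the swapped coloring contain \<open>x\<close>, so
      the degree bound limits their number to the search depth.\<close>
    have "card {j. j < ?m \<and> c' j \<noteq> ?ks v a b j} \<le> card {j. j < ?m \<and> x \<in> ends s j}"
      using c'(6) by (intro card_mono) auto
    then have "card {j. j < ?m \<and> c' j \<noteq> ?ks v a b j} \<le> r"
      using degm[of x] by linarith
    then have "W v a b" using c' unfolding W_def act by blast
    moreover have "v < s ''n'' 0"
    proof -
      obtain j where "j \<in> insert ?i {..<?i}" "v \<in> ends s j" using c'(3) by blast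
      then have "j < ?m" "v \<in> ends s j" using sub by blast+
      then show ?thesis using s(1) by (auto simp: ends_def bounded_degree_input_def)
    qed
    moreover have "a < Suc r" "b < Suc r" using c'(1,2) by simp_all
    ultimately show ?thesis by blast
  qed
  let ?B = "Sq mark_component (Sq swap_marked (search r r))"
  have wB: "writes ?B = {''j'', ''p'', ''q'', ''mark'', ''col''} \<union> writes (search r r)"
    by (auto simp: writes_mark_component writes_swap_marked)
  have body: "seeks ?Inv ?Good (W v a b) (unless_ok ?B) t"
    if t: "\<And>y. y \<notin> {''v'', ''a'', ''b''} \<Longrightarrow> y \<notin> writes ?B \<Longrightarrow> t y = s y"
      "t ''v'' 0 = v" "t ''a'' 0 = a" "t ''b'' 0 = b" "v < s ''n'' 0" "a < Suc r" "b < Suc r" for t v a b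
  proof (rule seeks_unless_ok)
    assume ok: "t ''ok'' 0 = 0" and inv: "\<forall>j. t ''col'' j \<le> r"
    have tf: "t y = s y" if "y \<in> {''src'', ''dst'', ''m'', ''n'', ''i'', ''cur''}" for y
    proof (rule t(1))
      show "y \<notin> {''v'', ''a'', ''b''}" using that by auto
      have "y \<notin> writes (search r r)" using that by (intro notin_writes_search) auto
      moreover have "y \<notin> {''j'', ''p'', ''q'', ''mark'', ''col''}" using that by auto
      ultimately show "y \<notin> writes ?B" unfolding wB by blast
    qed
    have en: "ends t = ends s" by (rule ends_cong; rule tf; simp)
    define t1 where "t1 = den mark_component t"
    have t1f: "t1 y = t y" if "y \<notin> {''j'', ''p'', ''q'', ''mark''}" for y
      using that by (simp add: t1_def den_frame writes_mark_component)
    have en1: "ends t1 = ends s" using en ends_cong[of t1 t] t1f by simp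
    have r1: "ends_in_range t" "ends_in_range t1"
      using rng tf t1f by (simp_all add: ends_in_range_def)
    have "marked t1 = state_comp t"
      unfolding t1_def using r1(1) by (rule marked_mark_component) (use t(2,5) in \<open>simp add: tf\<close>)
    also have "state_comp t = state_comp t1"
      unfolding state_comp_def en en1 using t1f by simp
    finally have m1: "marked t1 = state_comp t1" .
    define t2 where "t2 = den swap_marked t1"
    have t2f: "t2 y = t1 y" if "y \<notin> {''j'', ''col''}" for y
      using that by (simp add: t2_def den_frame writes_swap_marked)
    have col2: "t2 ''col'' = (\<lambda>j. if j < ?m then ?ks v a b j else t ''col'' j)"
      unfolding t2_def den_swap_marked[OF m1 r1(2)] en1 using t(2-4) by (simp add: t1f tf cong: if_cong)
    have en2: "ends t2 = ends s" using en1 ends_cong[of t2 t1] t2f by simp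
    have act2: "active t2 = active s"
      by (rule active_cong) (simp_all add: t1f t2f tf)
    have le2: "\<forall>j. t2 ''col'' j \<le> r"
    proof -
      have "?ks v a b j \<le> r" for j
        by (rule kempe_swap_le[OF _ _ le(1)]) (use t(6,7) in simp_all)
      then show ?thesis using inv by (simp add: col2)
    qed
    have ok2: "t2 ''ok'' 0 = 0" and m2: "t2 ''m'' 0 = ?m" "0 < t2 ''m'' 0"
      using ok s(2) by (simp_all add: t1f t2f tf)
    have np: "near_proper r r t2 (t2 ''col'')" if "W v a b"
    proof -
      note hW = that
      obtain c' where c': "\<forall>j. c' j \<le> r" "proper_on (ends s) (active s) c'"
        "card {j. j < ?m \<and> c' j \<noteq> ?ks v a b j} \<le> r" using hW unfolding W_def by blast
      \<comment> \<open>\<open>near_proper\<close> admits changes below \<open>m\<close> only, so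
        beyond \<open>m\<close> the witness copies what is stored there.\<close>
      let ?c = "\<lambda>j. if j < ?m then c' j else t ''col'' j"
      have eq: "{j. ?c j \<noteq> t2 ''col'' j} = {j. j < ?m \<and> c' j \<noteq> ?ks v a b j}"
        by (auto simp: col2)
      have "proper_on (ends s) (active s) ?c"
        using c'(2) by (auto simp: proper_on_def active_def)
      then show ?thesis
        unfolding near_proper_def en2 act2 m2
        by (intro exI[of _ ?c]) (use c' inv in \<open>auto simp: eq\<close>)
    qed
    have "den ?B t = den (search r r) t2" by (simp add: t1_def t2_def)
    moreover have "den (search r r) t2 ''ok'' 0 = 1 \<and> ?Good (den (search r r) t2 ''col'') \<or>
        den (search r r) t2 ''ok'' 0 = 0 \<and> den (search r r) t2 ''col'' = t2 ''col'' \<and>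
        \<not> near_proper r r t2 (t2 ''col'')"
      using den_search[of t2 r r, OF ok2 le2 m2(2)] unfolding en2 act2 .
    ultimately show "den ?B t ''ok'' 0 = 1 \<and> ?Good (den ?B t ''col'') \<or>
        den ?B t ''ok'' 0 = 0 \<and> ?Inv (den ?B t ''col'') \<and> \<not> W v a b"
      using np le2 by metis
  qed
  let ?Lb = "Loop ''b'' (Const (Suc r)) (unless_ok ?B)"
  let ?La = "Loop ''a'' (Const (Suc r)) ?Lb"
  have nw: "y \<notin> writes (search r r)" if "y \<in> {''v'', ''a'', ''b''}" for y
    using notin_writes_search[of y r r] that by auto
  have "seeks ?Inv ?Good (\<exists>v<aval (Var ''n'') s. \<exists>a<Suc r. \<exists>b<Suc r. W v a b) (attempt r) s"
    unfolding attempt_def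
  proof (rule seeks_Loop)
    fix v t assume v: "v < aval (Var ''n'') s"
      and t: "\<And>y. y \<noteq> ''v'' \<Longrightarrow> y \<notin> writes ?La \<Longrightarrow> t y = s y" "t ''v'' 0 = v"
    have "seeks ?Inv ?Good (\<exists>a<aval (Const (Suc r)) t. \<exists>b<Suc r. W v a b) ?La t"
    proof (rule seeks_Loop)
      fix a u assume a: "a < aval (Const (Suc r)) t"
        and u: "\<And>y. y \<noteq> ''a'' \<Longrightarrow> y \<notin> writes ?Lb \<Longrightarrow> u y = t y" "u ''a'' 0 = a"
      have "seeks ?Inv ?Good (\<exists>b<aval (Const (Suc r)) u. W v a b) ?Lb u"
      proof (rule seeks_Loop)
        fix b w assume b: "b < aval (Const (Suc r)) u"
          and w: "\<And>y. y \<noteq> ''b'' \<Longrightarrow> y \<notin> writes (unless_ok ?B) \<Longrightarrow> w y = u y" "w ''b'' 0 = b"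
        show "seeks ?Inv ?Good (W v a b) (unless_ok ?B) w"
        proof (rule body)
          show "w y = s y" if "y \<notin> {''v'', ''a'', ''b''}" "y \<notin> writes ?B" for y
            using that w(1)[of y] u(1)[of y] t(1)[of y] by simp
          have "w ''v'' = u ''v''" "w ''a'' = u ''a''" "u ''v'' = t ''v''"
            using w(1)[of "''v''"] w(1)[of "''a''"] u(1)[of "''v''"] nw
            by (simp_all add: writes_mark_component writes_swap_marked)
          then show "w ''v'' 0 = v" "w ''a'' 0 = a" using t u by simp_all
        qed (use v a b w in simp_all)
      qed simp_all
      then show "seeks ?Inv ?Good (\<exists>b<Suc r. W v a b) ?Lb u" by simp
    qed simp_all
    then show "seeks ?Inv ?Good (\<exists>a<Suc r. \<exists>b<Suc r. W v a b) ?La t" by simp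
  qed simp_all
  then have "?Good (den (attempt r) s ''col'')"
    using ex s(3) le(2) unfolding seeks_def by auto
  then show "proper_on (ends s) (active s) (den (attempt r) s ''col'')"
    "\<forall>j. den (attempt r) s ''col'' j \<le> r" by blast+
qed

lemma bounded_degree_input_cong:
  "t ''src'' = s ''src'' \<Longrightarrow> t ''dst'' = s ''dst'' \<Longrightarrow> t ''m'' = s ''m'' \<Longrightarrow> t ''n'' = s ''n'' \<Longrightarrow>
   bounded_degree_input r t = bounded_degree_input r s"
  by (simp only: bounded_degree_input_def ends_cong[of t s])

lemma den_extend:
  assumes s: "bounded_degree_input r s" "s ''i'' 0 < s ''m'' 0"
    and le: "\<forall>j. s ''cur'' j \<le> r" "\<forall>j. s ''col'' j \<le> r"
    and proper: "proper_on (ends s) {..<s ''i'' 0} (s ''cur'')"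
  shows "proper_on (ends s) {..<Suc (s ''i'' 0)} (den (extend r) s ''cur'')"
    "\<forall>j. den (extend r) s ''cur'' j \<le> r" "\<forall>j. den (extend r) s ''col'' j \<le> r"
proof -
  define s1 where "s1 = den (Asg ''ok'' (Const 0) (Const 0)) s"
  define s2 where "s2 = den (attempt r) s1"
  let ?L = "Loop ''j'' (Var ''m'') (Asg ''cur'' (Var ''j'') (Cell ''col'' (Var ''j'')))"
  have f1: "s1 y = s y" if "y \<noteq> ''ok''" for y using that by (simp add: s1_def)
  have e1: "ends s1 = ends s" "active s1 = active s"
    by (rule ends_cong active_cong; simp add: f1)+
  have b1: "bounded_degree_input r s1" using s(1) bounded_degree_input_cong[of s1 s] f1 by simp
  have 2: "proper_on (ends s) (active s) (s2 ''col'')" "\<forall>j. s2 ''col'' j \<le> r"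
    using den_attempt[OF b1] s le proper f1 unfolding e1 s2_def by (simp_all add: s1_def)
  have f2: "s2 y = s y" if "y \<in> {''m'', ''cur''}" for y
  proof -
    have "y \<notin> writes (search r r)" using that by (intro notin_writes_search) auto
    then have "y \<notin> writes (attempt r)" using that by (auto simp: writes_attempt)
    then show ?thesis using that den_frame[of y "attempt r" s1] f1[of y] by (auto simp: s2_def)
  qed
  have "den ?L s2 ''cur'' = (\<lambda>l. if l < aval (Var ''m'') s2 then s2 ''col'' l else s ''cur'' l)"
    by (rule den_Loop_invariant[where I = "\<lambda>j t. t ''cur'' = (\<lambda>l. if l < j then s2 ''col'' l else s ''cur'' l)"])
      (auto simp: fun_eq_iff less_Suc_eq f2)
  moreover have ext: "den (extend r) s = den ?L s2" by (simp add: extend_def s1_def s2_def)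
  ultimately have cur: "den (extend r) s ''cur'' =
      (\<lambda>l. if l < s ''m'' 0 then s2 ''col'' l else s ''cur'' l)" using f2 by simp
  show "\<forall>j. den (extend r) s ''cur'' j \<le> r" using 2 le by (simp add: cur)
  show "\<forall>j. den (extend r) s ''col'' j \<le> r" using 2 by (simp add: ext den_frame)
  have "active s = {..<Suc (s ''i'' 0)}" using s(2) by (auto simp: active_def)
  then show "proper_on (ends s) {..<Suc (s ''i'' 0)} (den (extend r) s ''cur'')"
    using 2(1) s(2) by (simp add: cur proper_on_def)
qed

lemma den_color_all:
  assumes s: "bounded_degree_input r s"
    and le: "\<forall>j. s ''cur'' j \<le> r" "\<forall>j. s ''col'' j \<le> r"
  defines "t \<equiv> den (Loop ''i'' (Var ''m'') (extend r)) s"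
  shows "proper_on (ends s) {..<s ''m'' 0} (t ''cur'')" "\<forall>j. t ''cur'' j \<le> r"
proof -
  \<comment> \<open>The bound on \<open>col\<close> is carried along because each round starts with
    whatever the previous one left in that bank.\<close>
  let ?I = "\<lambda>i t. proper_on (ends s) {..<i} (t ''cur'') \<and> (\<forall>j. t ''cur'' j \<le> r) \<and> (\<forall>j. t ''col'' j \<le> r)"
  have "?I (aval (Var ''m'') s) t"
    unfolding t_def
  proof (rule den_Loop_invariant[where I = ?I])
    fix i u assume i: "i < aval (Var ''m'') s"
      and fr: "\<And>y. y \<noteq> ''i'' \<Longrightarrow> y \<notin> writes (extend r) \<Longrightarrow> u y = s y"
      and u: "u ''i'' 0 = i" "?I i u"
    have f: "u y = s y" if "y \<in> {''src'', ''dst'', ''m'', ''n''}" for y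
    proof (rule fr)
      show "y \<noteq> ''i''" using that by auto
      have "y \<notin> writes (search r r)" using that by (intro notin_writes_search) auto
      then show "y \<notin> writes (extend r)" using that by (auto simp: writes_extend writes_attempt)
    qed
    have e: "ends u = ends s" by (rule ends_cong; rule f; simp)
    have "bounded_degree_input r u" using s bounded_degree_input_cong[of u s] f by simp
    then show "?I (Suc i) (den (extend r) u)"
      using den_extend[of r u] u i f unfolding e by simp
  qed (use le in \<open>auto simp: proper_on_def\<close>)
  then show "proper_on (ends s) {..<s ''m'' 0} (t ''cur'')" "\<forall>j. t ''cur'' j \<le> r" by simp_all
qed

text \<open>Hiding the shift or the reversal behind an injection \<open>f\<close> lets properness be
  transferred without distinguishing the two cases.\<close>

lemma den_finish:
  fixes r :: nat
  assumes le: "\<forall>j. s ''cur'' j \<le> r"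
  defines "t \<equiv> den (finish r) s" and "m \<equiv> s ''m'' 0"
  shows "\<exists>f. inj_on f {..r} \<and> (\<forall>k\<le>r. 1 \<le> f k) \<and> (\<forall>j<m. t ''col'' j = f (s ''cur'' j))"
    "2 * (\<Sum>j<m. t ''col'' j) \<le> m * (r + 2)"
proof -
  let ?c = "s ''cur''"
  let ?b1 = "Sq (Asg ''s'' (Const 0) (Add (Var ''s'') (Cell ''cur'' (Var ''j''))))
           (Asg ''t'' (Const 0) (Add (Var ''t'') (Sub (Const r) (Cell ''cur'' (Var ''j'')))))"
  let ?b2 = "Cnd (Less (Var ''t'') (Var ''s''))
       (Asg ''col'' (Var ''j'') (Sub (Const (Suc r)) (Cell ''cur'' (Var ''j''))))
       (Asg ''col'' (Var ''j'') (Add (Cell ''cur'' (Var ''j'')) (Const 1)))"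
  define s1 where "s1 = den (Asg ''t'' (Const 0) (Const 0)) (den (Asg ''s'' (Const 0) (Const 0)) s)"
  define s2 where "s2 = den (Loop ''j'' (Var ''m'') ?b1) s1"
  define S where "S = (\<Sum>j<m. ?c j)"
  define T where "T = (\<Sum>j<m. r - ?c j)"
  define f where "f k = (if T < S then Suc r - k else k + 1)" for k
  have m1: "aval (Var ''m'') s1 = m" by (simp add: s1_def m_def)
  have "(\<lambda>k u. u ''s'' 0 = (\<Sum>j<k. ?c j) \<and> u ''t'' 0 = (\<Sum>j<k. r - ?c j)) (aval (Var ''m'') s1) s2"
    unfolding s2_def
  proof (rule den_Loop_invariant)
    fix k u assume "\<And>y. y \<noteq> ''j'' \<Longrightarrow> y \<notin> writes ?b1 \<Longrightarrow> u y = s1 y" "u ''j'' 0 = k"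
      "u ''s'' 0 = (\<Sum>j<k. ?c j) \<and> u ''t'' 0 = (\<Sum>j<k. r - ?c j)"
    then show "den ?b1 u ''s'' 0 = (\<Sum>j<Suc k. ?c j) \<and> den ?b1 u ''t'' 0 = (\<Sum>j<Suc k. r - ?c j)"
      by (simp add: s1_def)
  qed (auto simp: s1_def)
  then have ST: "s2 ''s'' 0 = S" "s2 ''t'' 0 = T" unfolding m1 by (simp_all add: S_def T_def)
  have f2: "s2 y = s y" if "y \<in> {''cur'', ''m''}" for y
    using that by (auto simp: s2_def s1_def den_frame)
  have "\<forall>j<aval (Var ''m'') s2. den (Loop ''j'' (Var ''m'') ?b2) s2 ''col'' j = f (?c j)"
  proof (rule den_Loop_invariant[where I = "\<lambda>k u. \<forall>j<k. u ''col'' j = f (?c j)"])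
    fix k u assume "\<And>y. y \<noteq> ''j'' \<Longrightarrow> y \<notin> writes ?b2 \<Longrightarrow> u y = s2 y" "u ''j'' 0 = k"
      "\<forall>j<k. u ''col'' j = f (?c j)"
    then show "\<forall>j<Suc k. den ?b2 u ''col'' j = f (?c j)"
      using ST f2 by (simp add: f_def less_Suc_eq)
  qed auto
  then have col: "\<forall>j<m. t ''col'' j = f (?c j)"
    using f2 by (simp add: t_def finish_def s1_def s2_def m_def)
  have "inj_on f {..r}" "\<forall>k\<le>r. 1 \<le> f k" by (auto simp: inj_on_def f_def)
  then show "\<exists>f. inj_on f {..r} \<and> (\<forall>k\<le>r. 1 \<le> f k) \<and> (\<forall>j<m. t ''col'' j = f (s ''cur'' j))"
    using col by blast
  \<comment> \<open>The smaller of \<open>S\<close> and \<open>T\<close> is at most half of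
    \<open>m * r\<close>; the shift by one adds \<open>m\<close>.\<close>
  have "S + T = (\<Sum>j<m. r)"
    unfolding S_def T_def sum.distrib[symmetric] using le by simp
  then have ST': "S + T = m * r" by simp
  have "(\<Sum>j<m. t ''col'' j) = (if T < S then T + m else S + m)"
  proof (cases "T < S")
    case True
    have "(\<Sum>j<m. t ''col'' j) = (\<Sum>j<m. (r - ?c j) + 1)"
      using col le True by (intro sum.cong) (simp_all add: f_def Suc_diff_le)
    also have "\<dots> = T + (\<Sum>j<m. 1)" unfolding T_def by (rule sum.distrib)
    finally show ?thesis using True by simp
  next
    case False
    have "(\<Sum>j<m. t ''col'' j) = (\<Sum>j<m. ?c j + 1)"
      using col False by (intro sum.cong) (simp_all add: f_def)
    also have "\<dots> = S + (\<Sum>j<m. 1)" unfolding S_def by (rule sum.distrib)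
    finally show ?thesis using False by simp
  qed
  then show "2 * (\<Sum>j<m. t ''col'' j) \<le> m * (r + 2)"
    using ST' by (auto simp: algebra_simps)
qed

section \<open>Approximation ratio\<close>

text \<open>Induction on the largest element \<open>b\<close>: the smaller ones are distinct
  elements of \<open>{1..<b}\<close>, so \<open>b\<close> is at least the new cardinality.\<close>

lemma sum_distinct_positive:
  assumes "finite S" "0 \<notin> (S :: nat set)"
  shows "card S * (card S + 1) \<le> 2 * \<Sum>S"
  using assms
proof (induction S rule: finite_linorder_max_induct)
  case (insert b A)
  have "card A \<le> card {1..<b}"
    using insert by (intro card_mono) (auto simp: Suc_le_eq intro: gr0I)
  then have "card A + 1 \<le> b" using insert.prems by (cases b) auto
  moreover have "card A * (card A + 1) \<le> 2 * \<Sum>A" using insert by simp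
  moreover have "b \<notin> A" using insert by auto
  ultimately show ?case using insert(1) by (simp add: algebra_simps)
qed simp

lemma coloring_sum_lower_bound:
  assumes G: "regular_graph r V E" and \<alpha>: "proper_edge_coloring E \<alpha>"
  shows "card E * (r + 1) \<le> 2 * coloring_sum E \<alpha>"
proof -
  have V: "finite V" and E: "\<And>e. e \<in> E \<Longrightarrow> e \<subseteq> V \<and> card e = 2"
    and deg: "\<And>v. v \<in> V \<Longrightarrow> card {e \<in> E. v \<in> e} = r"
    using G by (auto simp: regular_graph_def simple_graph_def degree_at_def)
  have finE: "finite E" using V E by (auto intro: finite_subset[of _ "Pow V"])
  \<comment> \<open>Every edge is met at two vertices. With the constant 1 this is the handshake
    identity, with \<open>\<alpha>\<close> it gives twice the coloring sum.\<close>
  have swap: "(\<Sum>v\<in>V. \<Sum>e\<in>{e \<in> E. v \<in> e}. g e) = 2 * (\<Sum>e\<in>E. g e)" for g :: "_ \<Rightarrow> nat"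
  proof -
    have "(\<Sum>v\<in>V. \<Sum>e\<in>{e \<in> E. v \<in> e}. g e) = (\<Sum>e\<in>E. \<Sum>v\<in>{v \<in> V. v \<in> e}. g e)"
      using V finE by (rule sum.swap_restrict)
    also have "\<dots> = (\<Sum>e\<in>E. 2 * g e)"
    proof (rule sum.cong)
      fix e assume "e \<in> E"
      then have "{v \<in> V. v \<in> e} = e" using E by auto
      then show "(\<Sum>v\<in>{v \<in> V. v \<in> e}. g e) = 2 * g e" using E \<open>e \<in> E\<close> by simp
    qed simp
    finally show ?thesis by (simp add: sum_distrib_left)
  qed
  have loc: "r * (r + 1) \<le> 2 * (\<Sum>e\<in>{e \<in> E. v \<in> e}. \<alpha> e)" if "v \<in> V" for v
  proof -
    have inj: "inj_on \<alpha> {e \<in> E. v \<in> e}"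
      using \<alpha> unfolding proper_edge_coloring_def inj_on_def by blast
    have "0 \<notin> \<alpha> ` {e \<in> E. v \<in> e}" using \<alpha> by (force simp: proper_edge_coloring_def)
    from sum_distinct_positive[OF _ this] show ?thesis
      using finE by (simp add: card_image[OF inj] sum.reindex[OF inj] deg[OF that])
  qed
  have "card V * r = 2 * card E" using swap[of "\<lambda>_. 1"] deg by simp
  moreover have "card V * (r * (r + 1)) \<le> 2 * (2 * coloring_sum E \<alpha>)"
  proof -
    have "(\<Sum>v\<in>V. r * (r + 1)) \<le> (\<Sum>v\<in>V. 2 * (\<Sum>e\<in>{e \<in> E. v \<in> e}. \<alpha> e))"
      by (rule sum_mono) (rule loc)
    also have "\<dots> = 2 * (2 * coloring_sum E \<alpha>)"
      by (simp only: sum_distrib_left[symmetric] swap coloring_sum_def)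
    finally show ?thesis by simp
  qed
  ultimately have "2 * (card E * (r + 1)) \<le> 2 * (2 * coloring_sum E \<alpha>)"
    by (metis mult.assoc)
  then show ?thesis by simp
qed

text \<open>The excess \<open>1 / (r + 1)\<close> equals \<open>(r + 1) / (r + 1)^2\<close>, and
  \<open>r + 1 \<le> 2 * r\<close>. Multiplying instead of dividing by \<open>T\<close> covers the
  graph without edges.\<close>

lemma approximation_ratio:
  fixes r m S T :: nat
  assumes "r \<ge> 1" "2 * S \<le> m * (r + 2)" "m * (r + 1) \<le> 2 * T"
  shows "real S \<le> (1 + 2 * real r / (real r + 1)\<^sup>2) * real T"
proof -
  have "2 * real S \<le> real m * (real r + 2)" "real m * (real r + 1) \<le> 2 * real T"
    using assms(2,3)[THEN of_nat_mono[where 'a = real]] by (simp_all add: algebra_simps)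
  have "(real r + 2) / (real r + 1) \<le> 1 + 2 * real r / (real r + 1)\<^sup>2"
  proof -
    have "(real r + 2) / (real r + 1) = 1 + (real r + 1) / (real r + 1)\<^sup>2"
      by (simp add: divide_simps power2_eq_square)
    also have "\<dots> \<le> 1 + 2 * real r / (real r + 1)\<^sup>2"
      using assms(1) by (intro add_left_mono divide_right_mono) auto
    finally show ?thesis .
  qed
  have "2 * real S \<le> (real r + 2) / (real r + 1) * (real m * (real r + 1))"
    using \<open>2 * real S \<le> _\<close> by (simp add: divide_simps) (simp add: algebra_simps)
  also have "\<dots> \<le> (1 + 2 * real r / (real r + 1)\<^sup>2) * (2 * real T)"
    by (rule mult_mono) (fact, fact, simp, simp)
  finally show ?thesis by simp
qed

section \<open>From arrays to graphs\<close>

lemma input_state_simps: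
  "input_state n es ''n'' 0 = n"
  "input_state n es ''m'' 0 = length es"
  "j < length es \<Longrightarrow> ends (input_state n es) j = edge_of (es ! j)"
  "input_state n es ''cur'' j = 0" "input_state n es ''col'' j = 0"
  by (simp_all add: input_state_def ends_def edge_of_def)

lemma edge_listing_nth:
  assumes "edge_listing E es"
  shows "E = (\<lambda>j. edge_of (es ! j)) ` {..<length es}"
    "inj_on (\<lambda>j. edge_of (es ! j)) {..<length es}"
proof -
  have "set es = (!) es ` {..<length es}" by (auto simp: set_conv_nth)
  then show "E = (\<lambda>j. edge_of (es ! j)) ` {..<length es}"
    using assms by (metis edge_listing_def image_image list.set_map)
  show "inj_on (\<lambda>j. edge_of (es ! j)) {..<length es}"
    using assms by (auto simp: edge_listing_def inj_on_def distinct_conv_nth)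
qed

lemma bounded_degree_input_state:
  assumes G: "regular_graph r {..<n} E" and es: "edge_listing E es"
  shows "bounded_degree_input r (input_state n es)"
proof -
  let ?s = "input_state n es"
  let ?ed = "\<lambda>j. edge_of (es ! j)"
  note E = edge_listing_nth(1)[OF es] and inj = edge_listing_nth(2)[OF es]
  have e: "?ed j \<subseteq> {..<n} \<and> card (?ed j) = 2" if "j < length es" for j
    using G that E by (auto simp: regular_graph_def simple_graph_def)
  have "fst (es ! j) < n \<and> snd (es ! j) < n \<and> fst (es ! j) \<noteq> snd (es ! j)" if "j < length es" for j
    using e[OF that] by (auto simp: edge_of_def card_insert_if split: if_splits)
  then have 1: "\<forall>j<length es. ?s ''src'' j < n \<and> ?s ''dst'' j < n \<and> ?s ''src'' j \<noteq> ?s ''dst'' j"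
    by (simp add: input_state_def)
  have 2: "inj_on (ends ?s) {..<length es}"
    using inj by (simp add: inj_on_def input_state_simps)
  have 3: "card {j. j < length es \<and> v \<in> ends ?s j} \<le> r" for v
  proof -
    have eq: "{j. j < length es \<and> v \<in> ends ?s j} = {j. j < length es \<and> v \<in> ?ed j}"
      by (auto simp: input_state_simps)
    have "card {j. j < length es \<and> v \<in> ?ed j} = card (?ed ` {j. j < length es \<and> v \<in> ?ed j})"
      by (rule card_image[symmetric], rule inj_on_subset[OF inj]) auto
    also have "?ed ` {j. j < length es \<and> v \<in> ?ed j} = {e \<in> E. v \<in> e}" by (auto simp: E)
    also have "card {e \<in> E. v \<in> e} \<le> r"
    proof (cases "v < n")
      case True
      then show ?thesis using G by (simp add: regular_graph_def degree_at_def)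
    next
      case False
      then have "{e \<in> E. v \<in> e} = {}" using e by (auto simp: E)
      then show ?thesis by (simp only: card.empty le0)
    qed
    finally show ?thesis unfolding eq .
  qed
  show ?thesis unfolding bounded_degree_input_def input_state_simps using 1 2 3 by blast
qed

lemma proper_edge_coloring_of_array:
  assumes es: "edge_listing E es" and c: "proper_on (\<lambda>j. edge_of (es ! j)) {..<length es} c"
    and pos: "\<forall>j<length es. 1 \<le> c j"
  shows "\<exists>\<beta>. (\<forall>j<length es. \<beta> (edge_of (es ! j)) = c j) \<and> proper_edge_coloring E \<beta> \<and>
           coloring_sum E \<beta> = (\<Sum>j<length es. c j) \<and> card E = length es"
proof -
  let ?ed = "\<lambda>j. edge_of (es ! j)"
  note E = edge_listing_nth(1)[OF es] and inj = edge_listing_nth(2)[OF es]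
  define \<beta> where "\<beta> e = c (the_inv_into {..<length es} ?ed e)" for e
  have \<beta>: "\<beta> (?ed j) = c j" if "j < length es" for j
    using that the_inv_into_f_f[OF inj, of j] by (simp add: \<beta>_def)
  have "proper_edge_coloring E \<beta>"
    unfolding proper_edge_coloring_def
  proof (intro conjI ballI impI)
    fix e assume "e \<in> E"
    then show "1 \<le> \<beta> e" using E pos \<beta> by auto
  next
    fix e f assume ef: "e \<in> E" "f \<in> E" "e \<noteq> f \<and> e \<inter> f \<noteq> {}"
    then obtain p q where pq: "p < length es" "q < length es" "e = ?ed p" "f = ?ed q"
      unfolding E by blast
    moreover have "p \<noteq> q" using ef(3) pq by blast
    ultimately have "c p \<noteq> c q" using c ef(3) by (simp add: proper_on_def)
    then show "\<beta> e \<noteq> \<beta> f" using pq \<beta> by simp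
  qed
  moreover have "coloring_sum E \<beta> = (\<Sum>j<length es. c j)"
    unfolding coloring_sum_def E sum.reindex[OF inj] by (simp add: \<beta>)
  moreover have "card E = length es" unfolding E by (simp add: card_image[OF inj])
  ultimately show ?thesis using \<beta> by blast
qed

theorem theorem7:
  fixes r :: nat
  assumes "r \<ge> 3"
  shows "\<exists>(P :: com) (p :: nat poly). \<forall>(n :: nat) (E :: nat set set) (es :: (nat \<times> nat) list).
           regular_graph r {..<n} E \<and> edge_listing E es \<longrightarrow>
           (\<exists>t s \<beta>. exec P (input_state n es) t s \<and>
                    t \<le> poly p (input_size n es) \<and>
                    outputs_coloring s es \<beta> \<and>
                    proper_edge_coloring E \<beta> \<and>
                    real (coloring_sum E \<beta>)
                      \<le> (1 + 2 * real r / (real r + 1)\<^sup>2) * real (edge_chromatic_sum E))"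
proof (rule exI[of _ "compile (edge_coloring_prog r)"], rule exI[of _ "time_poly (edge_coloring_prog r)"],
    intro allI impI)
  fix n :: nat and E :: "nat set set" and es :: "(nat \<times> nat) list"
  assume "regular_graph r {..<n} E \<and> edge_listing E es"
  then have G: "regular_graph r {..<n} E" and es: "edge_listing E es" by blast+
  let ?P = "edge_coloring_prog r" and ?s = "input_state n es" and ?m = "length es"
  define u where "u = den (Loop ''i'' (Var ''m'') (extend r)) ?s"
  define s where "s = den (finish r) u"
  have s: "den ?P ?s = s" by (simp add: edge_coloring_prog_def u_def s_def)
  have "\<forall>j. ?s ''cur'' j \<le> r" "\<forall>j. ?s ''col'' j \<le> r" by (simp_all add: input_state_simps)
  note u = den_color_all[OF bounded_degree_input_state[OF G es] this, folded u_def,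
      unfolded input_state_simps]
  have "''m'' \<notin> writes (extend r)"
    using notin_writes_search[of "''m''" r r] by (simp add: writes_extend writes_attempt)
  then have um: "u ''m'' 0 = ?m" by (simp add: u_def den_frame input_state_simps)
  obtain f where f: "inj_on f {..r}" "\<forall>k\<le>r. 1 \<le> f k" "\<forall>j<?m. s ''col'' j = f (u ''cur'' j)"
    using den_finish(1)[of u r, OF u(2)] unfolding um s_def by blast
  have sum: "2 * (\<Sum>j<?m. s ''col'' j) \<le> ?m * (r + 2)"
    using den_finish(2)[of u r, OF u(2)] unfolding um s_def .
  have "proper_on (\<lambda>j. edge_of (es ! j)) {..<?m} (s ''col'')"
    unfolding proper_on_def
  proof (intro ballI impI)
    fix p q assume pq: "p \<in> {..<?m}" "q \<in> {..<?m}" "p \<noteq> q \<and> edge_of (es ! p) \<inter> edge_of (es ! q) \<noteq> {}"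
    then have "u ''cur'' p \<noteq> u ''cur'' q"
      using u(1) by (simp add: proper_on_def input_state_simps)
    then show "s ''col'' p \<noteq> s ''col'' q"
      using f u(2) pq by (simp add: inj_on_eq_iff)
  qed
  moreover have "\<forall>j<?m. 1 \<le> s ''col'' j" using f u(2) by simp
  ultimately obtain \<beta> where \<beta>: "\<forall>j<?m. \<beta> (edge_of (es ! j)) = s ''col'' j"
      "proper_edge_coloring E \<beta>" "coloring_sum E \<beta> = (\<Sum>j<?m. s ''col'' j)" "card E = ?m"
    using proper_edge_coloring_of_array[OF es, of "s ''col''"] by blast
  have "simple_graph {..<n} E" using G by (simp add: regular_graph_def)
  then obtain \<alpha> where \<alpha>: "proper_edge_coloring E \<alpha>" "edge_chromatic_sum E = coloring_sum E \<alpha>"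
    using edge_chromatic_sum_attained by blast
  \<comment> \<open>The lower bound holds for every proper coloring, in particular for an optimal
    \<open>\<alpha>\<close>.\<close>
  have "?m * (r + 1) \<le> 2 * edge_chromatic_sum E"
    using coloring_sum_lower_bound[OF G \<alpha>(1)] \<alpha>(2) \<beta>(4) by simp
  then have ratio: "real (coloring_sum E \<beta>)
      \<le> (1 + 2 * real r / (real r + 1)\<^sup>2) * real (edge_chromatic_sum E)"
    using approximation_ratio[of r "coloring_sum E \<beta>" ?m] assms sum \<beta>(3) by simp
  obtain t where t: "exec (compile ?P) ?s t s" "t \<le> poly (time_poly ?P) (input_size n es)"
    using exec_compile[OF wf_edge_coloring_prog, of r ?s] by (auto simp: s input_state_simps input_size_def)
  show "\<exists>t s \<beta>. exec (compile ?P) ?s t s \<and> t \<le> poly (time_poly ?P) (input_size n es) \<and>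
      outputs_coloring s es \<beta> \<and> proper_edge_coloring E \<beta> \<and>
      real (coloring_sum E \<beta>) \<le> (1 + 2 * real r / (real r + 1)\<^sup>2) * real (edge_chromatic_sum E)"
    using t \<beta> ratio unfolding outputs_coloring_def by blast
qed

end
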